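(* Let $\phi\in C^1(0,+\infty)$ be a real-valued function and consider the planar central force problem $$\ddot x=-\phi(r^2)x,\qquad \ddot y=-\phi(r^2)y,\qquad r^2=x^2+y^2,$$ for $(x,y)\in\mathbb{R}^2\setminus\{(0,0)\}$. Assume that the force is attractive somewhere, that is, $\phi(\eta)>0$ for some $\eta\in(0,\infty)$, and that all solutions near circular motions are periodic. Then there is a constant $K>0$ such that either $\phi(\eta)=K$ for all $\eta\in(0,\infty)$, or $\phi(\eta)=K\eta^{-3/2}$ for all $\eta\in(0,\infty)$.
   Context: A circular motion is a non-constant solution $(X(t),Y(t))$ of the system such that $X(t)^2+Y(t)^2\equiv r_0^2$ is constant. Identifying $\mathbb{R}^2$ with $\mathbb{C}$, circular motions are exactly the solutions $X(t)+iY(t)=r_0\xi_0e^{i\omega t}$ with $r_0>0$, $|\xi_0|=1$, $\phi(r_0^2)>0$ and $\omega=\pm\sqrt{\phi(r_0^2)}$. The phase space is $(\mathbb{C}\setminus\{0\})\times\mathbb{C}$ (position, velocity), and the orbit associated to the circular motion is $\gamma=\{(r_0\xi,i\omega r_0\xi):\xi\in\mathbb{C},\ |\xi|=1\}$. "All solutions near circular motions are periodic" means: for every circular motion, with orbit $\gamma$, there exists a neighborhood $\mathcal U\subset(\mathbb{C}\setminus\{0\})\times\mathbb{C}$ of $\gamma$ (whose size may depend on the circular motion) such that every solution $(x(t),y(t))$ of the system with $(x(0)+iy(0),\dot x(0)+i\dot y(0))\in\mathcal U$ is periodic. *)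

theory Defs
  imports "HOL-Analysis.Analysis"
begin

text \<open>
  Solutions live on a nonempty open interval \<open>I\<close> of times; the values of \<open>x\<close> and \<open>y\<close> outside \<open>I\<close>
  are irrelevant. The coefficient \<open>\<phi>\<close> of the force is a total function, but only its values on the
  positive half-line enter, since the position never vanishes.
\<close>

definition solution_on ::
    "(real \<Rightarrow> real) \<Rightarrow> real set \<Rightarrow> (real \<Rightarrow> real) \<Rightarrow> (real \<Rightarrow> real) \<Rightarrow> bool" where
  "solution_on \<phi> I x y \<longleftrightarrow>
     open I \<and> is_interval I \<and> I \<noteq> {} \<and>
     (\<forall>t\<in>I. (x t, y t) \<noteq> (0, 0) \<and>
        x differentiable (at t) \<and> y differentiable (at t) \<and>
        (deriv x has_real_derivative - \<phi> ((x t)\<^sup>2 + (y t)\<^sup>2) * x t) (at t) \<and>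
        (deriv y has_real_derivative - \<phi> ((x t)\<^sup>2 + (y t)\<^sup>2) * y t) (at t))"

text \<open>
  A solution without further qualification is a maximal one, i.e. one that cannot be extended to a
  larger interval. In particular nothing presupposes that solutions exist for all times.
\<close>

definition maximal_solution ::
    "(real \<Rightarrow> real) \<Rightarrow> real set \<Rightarrow> (real \<Rightarrow> real) \<Rightarrow> (real \<Rightarrow> real) \<Rightarrow> bool" where
  "maximal_solution \<phi> I x y \<longleftrightarrow>
     solution_on \<phi> I x y \<and>
     (\<forall>J u v. solution_on \<phi> J u v \<and> I \<subseteq> J \<and> (\<forall>t\<in>I. u t = x t \<and> v t = y t) \<longrightarrow> J = I)"

definition periodic_motion :: "real set \<Rightarrow> (real \<Rightarrow> real) \<Rightarrow> (real \<Rightarrow> real) \<Rightarrow> bool" where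
  "periodic_motion I x y \<longleftrightarrow>
     I = UNIV \<and> (\<exists>T>0. \<forall>t. x (t + T) = x t \<and> y (t + T) = y t)"

definition circular_motion ::
    "(real \<Rightarrow> real) \<Rightarrow> real set \<Rightarrow> (real \<Rightarrow> real) \<Rightarrow> (real \<Rightarrow> real) \<Rightarrow> bool" where
  "circular_motion \<phi> I x y \<longleftrightarrow>
     maximal_solution \<phi> I x y \<and>
     \<not> (\<lambda>t. (x t, y t)) constant_on I \<and>
     (\<exists>r0. \<forall>t\<in>I. (x t)\<^sup>2 + (y t)\<^sup>2 = r0\<^sup>2)"

definition phase_point :: "(real \<Rightarrow> real) \<Rightarrow> (real \<Rightarrow> real) \<Rightarrow> real \<Rightarrow> complex \<times> complex" where
  "phase_point x y t = (Complex (x t) (y t), Complex (deriv x t) (deriv y t))"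

definition phase_space :: "(complex \<times> complex) set" where
  "phase_space = (UNIV - {0}) \<times> UNIV"

text \<open>
  The orbit of a motion is the set of its phase points. For a circular motion this is
  \<open>{(r\<^sub>0 \<xi>, \<i> \<omega> r\<^sub>0 \<xi>) | \<bar>\<xi>\<bar> = 1}\<close>, see \<open>circular_motion_orbit\<close> below.
\<close>

definition orbit :: "real set \<Rightarrow> (real \<Rightarrow> real) \<Rightarrow> (real \<Rightarrow> real) \<Rightarrow> (complex \<times> complex) set" where
  "orbit I x y = phase_point x y ` I"

definition all_solutions_near_circular_motions_periodic :: "(real \<Rightarrow> real) \<Rightarrow> bool" where
  "all_solutions_near_circular_motions_periodic \<phi> \<longleftrightarrow>
     (\<forall>I X Y. circular_motion \<phi> I X Y \<longrightarrow>
        (\<exists>U. open U \<and> U \<subseteq> phase_space \<and> orbit I X Y \<subseteq> U \<and>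
           (\<forall>J x y. maximal_solution \<phi> J x y \<and> 0 \<in> J \<and> phase_point x y 0 \<in> U \<longrightarrow>
              periodic_motion J x y)))"


text \<open>Explicit form of the circular motions and of their orbits.\<close>

lemma rotation_solution:
  fixes a b w s :: real
  assumes ab: "(a, b) \<noteq> (0, 0)" and w: "w\<^sup>2 = \<phi> (a\<^sup>2 + b\<^sup>2)"
  defines "x \<equiv> \<lambda>t. a * cos (w * (t - s)) - b * sin (w * (t - s))"
      and "y \<equiv> \<lambda>t. b * cos (w * (t - s)) + a * sin (w * (t - s))"
  shows "solution_on \<phi> UNIV x y"
    and "deriv x t = - w * y t" and "deriv y t = w * x t"
    and "(x t)\<^sup>2 + (y t)\<^sup>2 = a\<^sup>2 + b\<^sup>2"
proof -
  have dx: "(x has_real_derivative - w * y t) (at t)" for t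
    unfolding x_def y_def by (auto intro!: derivative_eq_intros simp: algebra_simps)
  have dy: "(y has_real_derivative w * x t) (at t)" for t
    unfolding x_def y_def by (auto intro!: derivative_eq_intros simp: algebra_simps)
  have ex: "deriv x = (\<lambda>t. - w * y t)" and ey: "deriv y = (\<lambda>t. w * x t)"
    using dx dy by (auto intro!: ext DERIV_imp_deriv simp del: mult_minus_left)
  have norm: "(x t)\<^sup>2 + (y t)\<^sup>2 = a\<^sup>2 + b\<^sup>2" for t
  proof -
    have "(x t)\<^sup>2 + (y t)\<^sup>2 = (a\<^sup>2 + b\<^sup>2) * ((cos (w * (t - s)))\<^sup>2 + (sin (w * (t - s)))\<^sup>2)"
      unfolding x_def y_def by (simp only: power2_eq_square) algebra
    then show ?thesis by simp
  qed
  have nz: "(x t, y t) \<noteq> (0, 0)" for t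
    using norm[of t] ab by (auto simp: sum_power2_eq_zero_iff)
  have ddx: "(deriv x has_real_derivative - \<phi> ((x t)\<^sup>2 + (y t)\<^sup>2) * x t) (at t)" for t
    unfolding ex norm w[symmetric]
    by (rule derivative_eq_intros dy refl)+ (simp add: power2_eq_square)
  have ddy: "(deriv y has_real_derivative - \<phi> ((x t)\<^sup>2 + (y t)\<^sup>2) * y t) (at t)" for t
    unfolding ey norm w[symmetric]
    by (rule derivative_eq_intros dx refl)+ (simp add: power2_eq_square)
  show "solution_on \<phi> UNIV x y"
    unfolding solution_on_def using nz ddx ddy dx[unfolded has_field_derivative_def, THEN differentiableI] dy[unfolded has_field_derivative_def, THEN differentiableI]
    by auto
  show "deriv x t = - w * y t" "deriv y t = w * x t" "(x t)\<^sup>2 + (y t)\<^sup>2 = a\<^sup>2 + b\<^sup>2"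
    using ex ey norm by auto
qed

lemma circular_motion_rotation:
  assumes "circular_motion \<phi> I x y"
  obtains s w where "I = UNIV" "w \<noteq> 0" "w\<^sup>2 = \<phi> ((x s)\<^sup>2 + (y s)\<^sup>2)" "(x s, y s) \<noteq> (0, 0)"
    "x = (\<lambda>t. x s * cos (w * (t - s)) - y s * sin (w * (t - s)))"
    "y = (\<lambda>t. y s * cos (w * (t - s)) + x s * sin (w * (t - s)))"
proof -
  from assms obtain r where max: "maximal_solution \<phi> I x y"
    and nc: "\<not> (\<lambda>t. (x t, y t)) constant_on I"
    and r: "\<And>t. t \<in> I \<Longrightarrow> (x t)\<^sup>2 + (y t)\<^sup>2 = r\<^sup>2"
    unfolding circular_motion_def by blast
  from max have sol: "solution_on \<phi> I x y" unfolding maximal_solution_def by blast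
  then have I: "open I" "is_interval I" "I \<noteq> {}" unfolding solution_on_def by auto
  then obtain s where s: "s \<in> I" by auto
  have conv: "convex I" using I(2) by (simp add: is_interval_convex)
  have nz: "(x t, y t) \<noteq> (0, 0)" if "t \<in> I" for t
    using sol that unfolding solution_on_def by blast
  define p where "p = \<phi> (r\<^sup>2)"
  define l where "l t = x t * deriv y t - y t * deriv x t" for t
  have r0: "r\<^sup>2 > 0" using nz[OF s] r[OF s] by (auto simp: sum_power2_gt_zero_iff simp flip: r[OF s])
  have dx: "(x has_real_derivative deriv x t) (at t)" if "t \<in> I" for t
    using sol that unfolding solution_on_def
    by (auto simp: real_differentiable_def DERIV_deriv_iff_real_differentiable)
  have dy: "(y has_real_derivative deriv y t) (at t)" if "t \<in> I" for t
    using sol that unfolding solution_on_def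
    by (auto simp: real_differentiable_def DERIV_deriv_iff_real_differentiable)
  have ddx: "(deriv x has_real_derivative - p * x t) (at t)" if "t \<in> I" for t
    using sol that r[OF that] unfolding solution_on_def p_def by auto
  have ddy: "(deriv y has_real_derivative - p * y t) (at t)" if "t \<in> I" for t
    using sol that r[OF that] unfolding solution_on_def p_def by auto
  have const_deriv: "d = 0"
    if "t \<in> I" "(f has_real_derivative d) (at t)" "\<And>u. u \<in> I \<Longrightarrow> f u = c" for f t d c
  proof -
    have "((\<lambda>_. c) has_real_derivative d) (at t)"
      by (rule DERIV_cong_ev[THEN iffD1, OF refl _ refl that(2)])
         (use that I(1) in \<open>auto simp: eventually_nhds\<close>)
    then show ?thesis using DERIV_unique DERIV_const by blast
  qed
  have ortho: "x t * deriv x t + y t * deriv y t = 0" if "t \<in> I" for t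
  proof -
    have "((\<lambda>t. (x t)\<^sup>2 + (y t)\<^sup>2) has_real_derivative 2 * (x t * deriv x t + y t * deriv y t)) (at t)"
      by (auto intro!: derivative_eq_intros dx dy that simp: algebra_simps)
    from const_deriv[OF that this r] show ?thesis by simp
  qed
  have speed: "(deriv x t)\<^sup>2 + (deriv y t)\<^sup>2 = p * r\<^sup>2" if "t \<in> I" for t
  proof -
    have "((\<lambda>t. x t * deriv x t + y t * deriv y t) has_real_derivative
        (deriv x t)\<^sup>2 + (deriv y t)\<^sup>2 - p * ((x t)\<^sup>2 + (y t)\<^sup>2)) (at t)"
      by (auto intro!: derivative_eq_intros dx dy ddx ddy that simp: algebra_simps power2_eq_square)
    from const_deriv[OF that this ortho] r[OF that] show ?thesis by simp
  qed
  have zero: "f t = f s"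
    if "t \<in> I" "\<And>u. u \<in> I \<Longrightarrow> (f has_real_derivative 0) (at u)" for f :: "real \<Rightarrow> real" and t
    using has_field_derivative_zero_constant[OF conv, of f] that s
    by (metis has_field_derivative_at_within)
  have lc: "l t = l s" if "t \<in> I" for t
    by (rule zero[OF that]) (auto simp: l_def[abs_def] algebra_simps
        intro!: derivative_eq_intros dx dy ddx ddy)
  define w where "w = l s / r\<^sup>2"
  have x': "deriv x t = - w * y t" and y': "deriv y t = w * x t" if "t \<in> I" for t
  proof -
    have "r\<^sup>2 * deriv x t = - l t * y t"
      unfolding l_def using ortho[OF that] r[OF that] by algebra
    moreover have "r\<^sup>2 * deriv y t = l t * x t"
      unfolding l_def using ortho[OF that] r[OF that] by algebra
    ultimately show "deriv x t = - w * y t" "deriv y t = w * x t"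
      using lc[OF that] r0 by (auto simp: w_def field_simps)
  qed
  have w2: "w\<^sup>2 = p"
  proof -
    have "w\<^sup>2 * ((x s)\<^sup>2 + (y s)\<^sup>2) = p * r\<^sup>2"
      using speed[OF s] unfolding x'[OF s] y'[OF s] by (simp add: algebra_simps power_mult_distrib)
    then show ?thesis using r0 r[OF s] by simp
  qed
  have w0: "w \<noteq> 0"
  proof
    assume "w = 0"
    then have "x t = x s \<and> y t = y s" if "t \<in> I" for t
      using zero[OF that, of x] zero[OF that, of y] dx dy x' y' by fastforce
    then show False using nc unfolding constant_on_def by blast
  qed
  define u where "u t = x s * cos (w * (t - s)) - y s * sin (w * (t - s))" for t
  define v where "v t = y s * cos (w * (t - s)) + x s * sin (w * (t - s))" for t
  have uv: "u t = x t \<and> v t = y t" if "t \<in> I" for t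
  proof -
    let ?c = "\<lambda>t. cos (w * (t - s))" and ?s = "\<lambda>t. sin (w * (t - s))"
    have "((\<lambda>t. x t * ?c t + y t * ?s t) has_real_derivative 0) (at q)" if "q \<in> I" for q
      using x'[OF that] y'[OF that]
      by (auto intro!: derivative_eq_intros dx dy that simp: algebra_simps)
    from zero[OF \<open>t \<in> I\<close> this] have 1: "x t * ?c t + y t * ?s t = x s" by simp
    have "((\<lambda>t. y t * ?c t - x t * ?s t) has_real_derivative 0) (at q)" if "q \<in> I" for q
      using x'[OF that] y'[OF that]
      by (auto intro!: derivative_eq_intros dx dy that simp: algebra_simps)
    from zero[OF \<open>t \<in> I\<close> this] have 2: "y t * ?c t - x t * ?s t = y s" by simp
    have 3: "?c t * ?c t + ?s t * ?s t = 1"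
      by (simp flip: power2_eq_square)
    have inv1: "(e * c + f * d) * c - (f * c - e * d) * d = e * (c * c + d * d)"
      and inv2: "(f * c - e * d) * c + (e * c + f * d) * d = f * (c * c + d * d)"
      for c d e f :: real by (simp_all add: algebra_simps)
    show ?thesis unfolding u_def v_def
      using inv1[of "x t" "?c t" "y t" "?s t"] inv2[of "y t" "?c t" "x t" "?s t"]
      unfolding 1 2 3 by simp
  qed
  have "solution_on \<phi> UNIV u v"
    unfolding u_def[abs_def] v_def[abs_def]
    by (rule rotation_solution(1)[OF nz[OF s]]) (simp add: w2 p_def r[OF s])
  with max uv have I: "I = UNIV" unfolding maximal_solution_def by blast
  with uv have "u = x" "v = y" by auto
  then show thesis
    using that[OF I w0 _ nz[OF s]] w2 r[OF s] p_def u_def[abs_def] v_def[abs_def] by metis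
qed

lemma circular_motion_iff:
  "circular_motion \<phi> I x y \<longleftrightarrow>
     I = UNIV \<and>
     (\<exists>r0 \<xi>0 \<omega>. r0 > 0 \<and> norm \<xi>0 = 1 \<and> \<phi> (r0\<^sup>2) > 0 \<and> \<omega>\<^sup>2 = \<phi> (r0\<^sup>2) \<and>
        (\<forall>t. Complex (x t) (y t) = of_real r0 * \<xi>0 * cis (\<omega> * t)))"
  (is "?L \<longleftrightarrow> ?R")
proof
  assume ?L
  then obtain s w where *: "I = UNIV" "w \<noteq> 0" "w\<^sup>2 = \<phi> ((x s)\<^sup>2 + (y s)\<^sup>2)" "(x s, y s) \<noteq> (0, 0)"
    "x = (\<lambda>t. x s * cos (w * (t - s)) - y s * sin (w * (t - s)))"
    "y = (\<lambda>t. y s * cos (w * (t - s)) + x s * sin (w * (t - s)))"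
    by (rule circular_motion_rotation)
  define z where "z = Complex (x s) (y s)"
  have z: "z \<noteq> 0" "(norm z)\<^sup>2 = (x s)\<^sup>2 + (y s)\<^sup>2"
    using *(4) by (auto simp: z_def complex_eq_iff cmod_power2)
  have "Complex (x t) (y t) = of_real (norm z) * (sgn z * cis (- (w * s))) * cis (w * t)" for t
  proof -
    have "Complex (x t) (y t) = z * cis (w * (t - s))"
      by (subst *(5), subst *(6)) (simp add: z_def complex_eq_iff)
    also have "cis (w * (t - s)) = cis (- (w * s)) * cis (w * t)"
      by (simp add: cis_mult algebra_simps)
    also have "z = of_real (norm z) * sgn z"
      using z(1) by (simp add: sgn_eq)
    finally show ?thesis by (simp add: mult.assoc)
  qed
  moreover have "w\<^sup>2 > 0" using *(2) by simp
  ultimately show ?R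
    using z *(1,3) by (intro conjI exI[of _ "norm z"] exI[of _ "sgn z * cis (- (w * s))"] exI[of _ w])
       (auto simp: norm_mult norm_sgn)
next
  assume ?R
  then obtain r0 \<xi>0 \<omega> where *: "I = UNIV" "r0 > 0" "norm \<xi>0 = 1" "\<phi> (r0\<^sup>2) > 0" "\<omega>\<^sup>2 = \<phi> (r0\<^sup>2)"
    and z: "\<And>t. Complex (x t) (y t) = of_real r0 * \<xi>0 * cis (\<omega> * t)" by blast
  define a b where "a = Re (of_real r0 * \<xi>0)" and "b = Im (of_real r0 * \<xi>0)"
  have ab: "a\<^sup>2 + b\<^sup>2 = r0\<^sup>2"
    using *(2,3) cmod_power2[of "of_real r0 * \<xi>0"] by (simp add: a_def b_def norm_mult)
  have ab0: "(a, b) \<noteq> (0, 0)" using ab *(2) by auto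
  have w0: "\<omega> \<noteq> 0" using *(4,5) by auto
  have x: "x = (\<lambda>t. a * cos (\<omega> * (t - 0)) - b * sin (\<omega> * (t - 0)))"
    using z by (auto simp: complex_eq_iff a_def b_def)
  have y: "y = (\<lambda>t. b * cos (\<omega> * (t - 0)) + a * sin (\<omega> * (t - 0)))"
    using z by (auto simp: complex_eq_iff a_def b_def algebra_simps)
  have ww: "\<omega>\<^sup>2 = \<phi> (a\<^sup>2 + b\<^sup>2)" using *(5) ab by simp
  have rot: "solution_on \<phi> UNIV x y" "deriv x t = - \<omega> * y t" "deriv y t = \<omega> * x t"
    "(x t)\<^sup>2 + (y t)\<^sup>2 = a\<^sup>2 + b\<^sup>2" for t
    unfolding x y by (rule rotation_solution[where \<phi> = \<phi>, OF ab0 ww])+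
  have "\<not> (\<lambda>t. (x t, y t)) constant_on UNIV"
  proof
    assume "(\<lambda>t. (x t, y t)) constant_on UNIV"
    then obtain c where "\<And>t. (x t, y t) = c" unfolding constant_on_def by auto
    then have "x = (\<lambda>_. fst c)" "y = (\<lambda>_. snd c)"
      by (metis fst_conv, metis snd_conv)
    then have "deriv x 0 = 0" "deriv y 0 = 0" by simp_all
    then have "x 0 = 0" "y 0 = 0" using rot(2,3)[of 0] w0 by auto
    then show False using rot(4)[of 0] ab *(2) by simp
  qed
  moreover have "maximal_solution \<phi> UNIV x y"
    using rot(1) unfolding maximal_solution_def by blast
  ultimately show ?L
    unfolding circular_motion_def using *(1) rot(4) ab by auto
qed

lemma circular_motion_orbit:
  assumes \<omega>: "\<omega> \<noteq> 0" and norm: "norm \<xi>0 = 1"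
    and z: "\<And>t. Complex (x t) (y t) = of_real r0 * \<xi>0 * cis (\<omega> * t)"
  shows "orbit UNIV x y =
    {(of_real r0 * \<xi>, \<i> * of_real \<omega> * of_real r0 * \<xi>) | \<xi>. norm \<xi> = 1}"
proof -
  have x: "x = (\<lambda>t. Re (of_real r0 * \<xi>0 * cis (\<omega> * t)))"
    and y: "y = (\<lambda>t. Im (of_real r0 * \<xi>0 * cis (\<omega> * t)))"
    unfolding z[symmetric] by simp_all
  have "(x has_real_derivative - \<omega> * y t) (at t)" "(y has_real_derivative \<omega> * x t) (at t)" for t
    unfolding x y by (auto intro!: derivative_eq_intros simp: algebra_simps)
  then have d: "deriv x t = - \<omega> * y t" "deriv y t = \<omega> * x t" for t
    by (metis DERIV_imp_deriv)+
  have pt: "phase_point x y t =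
      (of_real r0 * (\<xi>0 * cis (\<omega> * t)), \<i> * of_real \<omega> * of_real r0 * (\<xi>0 * cis (\<omega> * t)))" for t
  proof -
    have "Complex (deriv x t) (deriv y t) = \<i> * of_real \<omega> * Complex (x t) (y t)"
      by (simp add: d complex_eq_iff)
    then show ?thesis unfolding phase_point_def z by (simp add: mult.assoc)
  qed
  have "\<exists>t. \<xi> = \<xi>0 * cis (\<omega> * t)" if "norm \<xi> = 1" for \<xi>
  proof -
    have "norm (\<xi> / \<xi>0) = 1" "\<xi>0 \<noteq> 0" using that norm by (auto simp: norm_divide)
    then have "cis (Arg (\<xi> / \<xi>0)) = \<xi> / \<xi>0"
      by (metis cis_Arg norm_eq_zero scaleR_one sgn_div_norm inverse_1 zero_neq_one)
    then have "\<xi> = \<xi>0 * cis (\<omega> * (Arg (\<xi> / \<xi>0) / \<omega>))"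
      using \<omega> \<open>\<xi>0 \<noteq> 0\<close> by simp
    then show ?thesis by blast
  qed
  moreover have "norm (\<xi>0 * cis (\<omega> * t)) = 1" for t by (simp add: norm_mult norm)
  ultimately show ?thesis unfolding orbit_def image_def pt by blast
qed

end

theory Submission
  imports Defs "HOL-Real_Asymp.Real_Asymp"
begin

text \<open>
  A local form of Bertrand's theorem. As a function of the polar angle, the reciprocal radius
  \<open>u = 1 / r\<close> of a motion with angular momentum \<open>l\<close> obeys the conservative equation
  \<open>u'' = - f u\<close> with \<open>f u = u - \<phi> (1 / u\<^sup>2) / (l\<^sup>2 * u^3)\<close> (Binet). Its equilibria are the circular
  motions, and at the one with \<open>r\<^sup>2 = \<rho>\<close> the derivative of \<open>f\<close> is \<open>\<kappa> = 4 + 2 * \<rho> * \<phi>' \<rho> / \<phi> \<rho>\<close>.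

  If \<open>\<kappa> < 0\<close>, some motion approaches the circular one with strictly monotone radius and is not
  periodic (\<open>no_saddle\<close>). If \<open>\<kappa> > 0\<close>, the nearby motions oscillate radially, and periodicity means that
  the angle swept during one radial oscillation is a rational multiple of \<open>2 * pi\<close>
  (\<open>apsidal_angle_rational\<close>). This angle depends continuously on the amplitude, so it is constant, equal
  to its limit \<open>2 * pi / sqrt \<kappa>\<close> at amplitude zero (\<open>isochronous\<close>). So \<open>sqrt \<kappa>\<close> is rational at every
  circular motion, and by continuity in \<open>\<rho>\<close> it is constant on every interval where \<open>\<phi> > 0\<close>. There
  \<open>\<phi>\<close> is a power function, hence positive at the ends as well, and the interval is the whole half-line.

  It remains to find the exponents. For \<open>\<kappa> = 0\<close> there are unbounded spirals
  (\<open>no_inverse_cube_force\<close>). For \<open>\<kappa> > 0\<close> the oscillations of \<open>u'' = - u + u powr m\<close> about \<open>u = 1\<close>, where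
  \<open>m = 1 - \<kappa>\<close>, must have a period independent of the amplitude; the first correction to the period
  vanishes only for \<open>m * (m + 3) = 0\<close> (\<open>second_order_isochrony\<close>, \<open>power_force_exponent\<close>).

  Both kinds of motion are written down explicitly in the energy coordinate of \<open>energy_coordinate\<close>,
  which also expresses the apsidal angle as the integral of a continuous function. The periodicity
  hypothesis speaks of maximal solutions; it is brought to bear on these explicit motions by extending
  them (\<open>maximal_extension\<close>).
\<close>

section \<open>Antiderivatives and changes of time\<close>

lemma continuous_on_of_DERIV:
  assumes "\<And>x. (f has_real_derivative D x) (at x)"
  shows "continuous_on A f"
  by (rule DERIV_continuous_on[where D=D]) (rule has_field_derivative_at_within[OF assms])

lemma antiderivative_on_line:
  fixes p :: "real \<Rightarrow> real"
  assumes "continuous_on UNIV p"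
  obtains Q where "Q 0 = 0" "\<And>t. (Q has_real_derivative p t) (at t)"
proof -
  define Q where "Q t = (LBINT s=0..t. p s)" for t :: real
  have "(Q has_real_derivative p t) (at t)" for t
  proof -
    define a b where "a = min 0 t - 1" and "b = max 0 t + 1"
    have ab: "a \<le> 0" "0 \<le> b" "a < t" "t < b" by (auto simp: a_def b_def)
    have "((\<lambda>u. LBINT y=ereal 0..u. p y) has_vector_derivative p t) (at t within {a..b})"
      by (rule interval_integral_FTC2) (use ab assms in \<open>auto intro: continuous_on_subset\<close>)
    then show ?thesis
      using ab by (simp add: Q_def[abs_def] at_within_Icc_at has_real_derivative_iff_has_vector_derivative zero_ereal_def)
  qed
  moreover have "Q 0 = 0" by (simp add: Q_def zero_ereal_def)
  ultimately show thesis using that by blast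
qed

text \<open>
  Orbits are built in a parameter \<open>s\<close> in which the energy is explicit; physical time is then
  \<open>t = \<integral> p ds\<close>. The lower bound on the rate \<open>p\<close> makes \<open>t\<close> range over the whole line, so
  that \<open>s = \<tau> t\<close> is defined for all times.
\<close>

lemma time_change:
  fixes p :: "real \<Rightarrow> real"
  assumes cont: "continuous_on UNIV p" and c: "c > 0" "\<And>s. c \<le> p s"
  obtains \<tau> where "\<tau> 0 = 0" "strict_mono \<tau>" "surj \<tau>"
    "\<And>t. (\<tau> has_real_derivative 1 / p (\<tau> t)) (at t)"
proof -
  obtain Q where Q0: "Q 0 = 0" and dQ: "\<And>t. (Q has_real_derivative p t) (at t)"
    using antiderivative_on_line[OF cont] by blast
  have pos: "p s > 0" for s using c[of] by (meson less_le_trans)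
  have mono: "strict_mono Q"
    by (rule strict_monoI) (meson DERIV_pos_imp_increasing dQ pos)
  have contQ: "continuous_on A Q" for A
    using dQ by (rule continuous_on_of_DERIV)
  have mono2: "mono (\<lambda>s. Q s - c * s)"
  proof (rule monoI)
    fix s t :: real assume "s \<le> t"
    then show "Q s - c * s \<le> Q t - c * t"
    proof (rule DERIV_nonneg_imp_nondecreasing)
      fix x show "\<exists>y. ((\<lambda>s. Q s - c * s) has_real_derivative y) (at x) \<and> 0 \<le> y"
        using c(2)[of x] by (intro exI[of _ "p x - c"] conjI) (auto intro!: derivative_eq_intros dQ)
    qed
  qed
  have "\<exists>s. Q s = t" for t
  proof -
    define m where "m = \<bar>t\<bar> / c"
    have m: "m \<ge> 0" "c * m = \<bar>t\<bar>" using c by (auto simp: m_def)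
    have "Q (- m) \<le> t" "t \<le> Q m"
      using monoD[OF mono2, of "-m" 0] monoD[OF mono2, of 0 m] m Q0 by auto
    then show ?thesis using IVT'[of Q "-m" t m] contQ m by auto
  qed
  then have bij: "bij Q" using mono unfolding bij_def
    by (metis strict_mono_imp_inj_on surj_def)
  define \<tau> where "\<tau> = inv Q"
  have i: "\<tau> (Q s) = s" "Q (\<tau> t) = t" for s t
    using bij unfolding \<tau>_def by (simp_all add: bij_is_inj bij_is_surj surj_f_inv_f)
  have sm: "strict_mono \<tau>"
    by (rule strict_monoI) (metis i(2) mono strict_mono_less)
  have ct: "isCont \<tau> t" for t
    by (metis i isCont_inverse_function[of 1 "\<tau> t" \<tau> Q] zero_less_one
        contQ[of UNIV] continuous_on_eq_continuous_at open_UNIV UNIV_I)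
  have "(\<tau> has_real_derivative inverse (p (\<tau> t))) (at t)" for t
    by (rule DERIV_inverse_function[where f=Q and a="t - 1" and b="t + 1"])
       (use i dQ pos ct less_imp_neq[OF pos] in auto)
  then show thesis
    using that[of \<tau>] i sm Q0 by (metis inverse_eq_divide surj_def)
qed

text \<open>
  A nonconstant continuous function on an interval takes uncountably many values. This turns the
  rationality of apsidal angles and frequencies into their constancy.
\<close>

lemma constant_of_countable_range:
  fixes f :: "real \<Rightarrow> real"
  assumes "connected S" "continuous_on S f" "countable (f ` S)" "a \<in> S" "b \<in> S"
  shows "f a = f b"
proof (rule ccontr)
  assume "f a \<noteq> f b"
  then have "uncountable (f ` S)"
    using connected_uncountable[OF connected_continuous_image[OF assms(2,1)]] assms(4,5) by blast
  then show False using assms(3) by simp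
qed

section \<open>The energy coordinate at an equilibrium\<close>

text \<open>
  Near an equilibrium of \<open>u'' = - f u\<close> with \<open>f' > 0\<close> the energy is \<open>(u'\<^sup>2 + y\<^sup>2) / 2\<close>, where
  \<open>y\<^sup>2 / 2\<close> is the potential energy and \<open>y\<close> has the sign of the displacement. The locale describes
  the inverse \<open>u = U y\<close> of this coordinate. The equation \<open>f (U y) * U' y = y\<close> says that the potential
  has derivative \<open>f\<close>; it makes \<open>u = U (a * sin s)\<close>, \<open>u' = a * cos s\<close>, \<open>d\<theta> = U' (a * sin s) ds\<close> a solution.
  The interval is closed so that bounds follow from compactness.
\<close>

locale energy_chart =
  fixes f :: "real \<Rightarrow> real" and S :: "real set" and b :: real and U U' :: "real \<Rightarrow> real"
  assumes b: "b > 0"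
    and cont_U': "continuous_on {-b..b} U'"
    and U_mem: "y \<in> {-b..b} \<Longrightarrow> U y \<in> S"
    and DERIV_U: "y \<in> {-b..b} \<Longrightarrow> (U has_real_derivative U' y) (at y)"
    and U'_pos: "y \<in> {-b..b} \<Longrightarrow> U' y > 0"
    and energy: "y \<in> {-b..b} \<Longrightarrow> f (U y) * U' y = y"
begin

lemma cont_U: "continuous_on {-b..b} U"
  by (rule DERIV_continuous_on[where D=U']) (rule has_field_derivative_at_within[OF DERIV_U])

lemma U_less: "U y < U y'" if "-b \<le> y" "y < y'" "y' \<le> b"
proof (rule DERIV_pos_imp_increasing[OF \<open>y < y'\<close>])
  fix x assume "y \<le> x" "x \<le> y'"
  with that have "x \<in> {-b..b}" by simp
  with DERIV_U U'_pos show "\<exists>d. (U has_real_derivative d) (at x) \<and> 0 < d" by blast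
qed

text \<open>
  In Binet's equation time elapses at the rate \<open>U' / (l * U\<^sup>2)\<close>, so this is the bound needed to invert
  the passage to physical time.
\<close>

lemma clock_rate_bound:
  assumes "S \<subseteq> {0<..}"
  obtains c where "c > 0" "\<And>y. y \<in> {-b..b} \<Longrightarrow> c \<le> U' y / (U y)\<^sup>2"
proof -
  have pos: "U y > 0" if "y \<in> {-b..b}" for y using U_mem[OF that] assms by auto
  have "continuous_on {-b..b} (\<lambda>y. U' y / (U y)\<^sup>2)"
    using pos by (intro continuous_intros cont_U cont_U') (auto dest!: pos)
  then obtain m where m: "m \<in> {-b..b}" "\<And>y. y \<in> {-b..b} \<Longrightarrow> U' m / (U m)\<^sup>2 \<le> U' y / (U y)\<^sup>2"
    using continuous_attains_inf[of "{-b..b}" "\<lambda>y. U' y / (U y)\<^sup>2"] b by auto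
  then show thesis using that[of "U' m / (U m)\<^sup>2"] U'_pos[OF m(1)] pos[OF m(1)] by simp
qed

end

text \<open>
  With \<open>V\<close> the antiderivative of \<open>f\<close>, the function \<open>Y = \<plusminus> sqrt (2 * V)\<close> is continuously differentiable
  although \<open>V\<close> is only twice differentiable at the equilibrium: off the equilibrium \<open>Y' = f / Y\<close>,
  and since \<open>f / h\<close> and \<open>2 * V / h\<^sup>2\<close> both tend to \<open>k\<close>, this quotient tends to \<open>sqrt k\<close>, which is also
  the derivative there. Hence \<open>Y\<close> is a local diffeomorphism, and \<open>U\<close> is its inverse.
\<close>

lemma energy_coordinate:
  fixes f :: "real \<Rightarrow> real" and u0 k :: real
  assumes S: "open S" "u0 \<in> S" and cont: "continuous_on S f"
    and f0: "f u0 = 0" and df: "(f has_real_derivative k) (at u0)" and k: "k > 0"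
  obtains b U U' where "energy_chart f S b U U'" "U 0 = u0" "U' 0 = 1 / sqrt k"
proof -
  have lim: "((\<lambda>h. f (u0 + h) / h) \<longlongrightarrow> k) (at 0)"
    using df f0 by (simp add: has_field_derivative_def field_has_derivative_at DERIV_def)
  then have "\<forall>\<^sub>F h in at 0. f (u0 + h) / h > 0"
    using k by (rule order_tendstoD)
  then obtain d1 where d1: "d1 > 0" "\<And>h. h \<noteq> 0 \<Longrightarrow> \<bar>h\<bar> < d1 \<Longrightarrow> f (u0 + h) / h > 0"
    unfolding eventually_at dist_real_def by auto
  obtain d2 where d2: "d2 > 0" "ball u0 d2 \<subseteq> S" using S open_contains_ball by blast
  define d where "d = min d1 d2 / 2"
  have d: "d > 0" "d < d1" "d < d2" using d1 d2 by (auto simp: d_def)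
  have inS: "u0 + h \<in> S" if "\<bar>h\<bar> \<le> d" for h
    using d2(2) that d by (auto simp: dist_real_def subset_iff)
  \<comment> \<open>Clamping the argument makes the force continuous on the whole line.\<close>
  define F where "F h = f (u0 + max (- d) (min d h))" for h
  have "continuous_on UNIV (f \<circ> (\<lambda>h. u0 + max (- d) (min d h)))"
    by (intro continuous_on_compose continuous_intros continuous_on_subset[OF cont])
       (use inS d in auto)
  then have contF: "continuous_on UNIV F" by (simp add: F_def[abs_def] o_def)
  obtain V where V0: "V 0 = 0" and dV: "\<And>h. (V has_real_derivative F h) (at h)"
    using antiderivative_on_line[OF contF] by blast
  have Fpos: "F h > 0" if "h > 0" for h
    using d1(2)[of "min d h"] that d by (auto simp: F_def zero_less_divide_iff min_def split: if_splits)
  have Fneg: "F h < 0" if "h < 0" for h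
    using d1(2)[of "max (-d) h"] that d by (auto simp: F_def zero_less_divide_iff max_def split: if_splits)
  have F0: "F 0 = 0" using d f0 by (simp add: F_def)
  have Vpos: "V h > 0" if "h \<noteq> 0" for h
  proof (cases "h > 0")
    case True
    have "V 0 < V h"
    proof (rule DERIV_pos_imp_increasing_open[OF True])
      show "\<exists>y. (V has_real_derivative y) (at x) \<and> 0 < y" if "0 < x" for x using dV Fpos that by blast
      show "continuous_on {0..h} V"
        using dV by (rule continuous_on_of_DERIV)
    qed
    then show ?thesis using V0 by simp
  next
    case False
    then have "h < 0" using that by simp
    have "V h > V 0"
    proof (rule DERIV_neg_imp_decreasing_open[OF \<open>h < 0\<close>])
      show "\<exists>y. (V has_real_derivative y) (at x) \<and> y < 0" if "x < 0" for x using dV Fneg that by blast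
      show "continuous_on {h..0} V"
        using dV by (rule continuous_on_of_DERIV)
    qed
    then show ?thesis using V0 by simp
  qed
  have limF: "((\<lambda>h. F h / h) \<longlongrightarrow> k) (at 0)"
  proof (rule Lim_transform_eventually[OF lim])
    have "\<forall>\<^sub>F h in at (0::real). \<bar>h\<bar> < d" using d(1) by (auto simp: eventually_at dist_real_def)
    then show "\<forall>\<^sub>F h in at 0. f (u0 + h) / h = F h / h"
      by eventually_elim (auto simp: F_def min_def max_def)
  qed
  have limV: "((\<lambda>h. V h / h\<^sup>2) \<longlongrightarrow> k / 2) (at 0)"
  proof (rule lhopital[where f'=F and g'="\<lambda>h. 2 * h"])
    show "(V \<longlongrightarrow> 0) (at 0)" using dV[of 0] V0 DERIV_isCont isCont_def by metis
    show "((\<lambda>h::real. h\<^sup>2) \<longlongrightarrow> 0) (at 0)" by (auto intro!: tendsto_eq_intros)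
    show "((\<lambda>h. F h / (2 * h)) \<longlongrightarrow> k / 2) (at 0)"
      using tendsto_divide[OF limF tendsto_const[of 2]] by (simp add: field_simps)
    show "\<forall>\<^sub>F h in at 0. ((\<lambda>h::real. h\<^sup>2) has_real_derivative 2 * h) (at h)"
      by (intro always_eventually allI) (auto intro!: derivative_eq_intros)
  qed (auto simp: eventually_at_filter dV)
  define Y where "Y h = sgn h * sqrt (2 * V h)" for h
  define Y' where "Y' h = (if h = 0 then sqrt k else F h / Y h)" for h
  have Y0: "Y 0 = 0" by (simp add: Y_def)
  have Yne: "Y h \<noteq> 0" if "h \<noteq> 0" for h using Vpos[OF that] that by (simp add: Y_def sgn_0_0)
  have Ysq: "(Y h)\<^sup>2 = 2 * V h" for h
    using Vpos[of h] V0 by (cases "h = 0") (auto simp: Y_def power_mult_distrib sgn_if)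
  have limY: "((\<lambda>h. Y h / h) \<longlongrightarrow> sqrt k) (at 0)"
  proof -
    have "((\<lambda>h. sqrt (2 * (V h / h\<^sup>2))) \<longlongrightarrow> sqrt (2 * (k / 2))) (at 0)"
      by (intro tendsto_intros limV)
    moreover have "sqrt (2 * (V h / h\<^sup>2)) = Y h / h" if "h \<noteq> 0" for h
      using that by (auto simp: Y_def real_sqrt_divide sgn_if real_sqrt_mult)
    ultimately show ?thesis
      by (auto intro: Lim_transform_eventually simp: eventually_at_filter)
  qed
  have Y'pos: "Y' h > 0" for h
    using Fpos[of h] Fneg[of h] Vpos[of h] k by (auto simp: Y'_def Y_def sgn_if divide_neg_neg divide_neg_pos)
  have dY: "(Y has_real_derivative Y' h) (at h)" for h
  proof (cases "h = 0")
    case True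
    then show ?thesis using limY Y0
      by (simp add: DERIV_def Y'_def)
  next
    case False
    have s: "((\<lambda>h. sqrt (2 * V h)) has_real_derivative F h / sqrt (2 * V h)) (at h)"
      using Vpos[OF False] by (auto intro!: derivative_eq_intros dV simp: field_simps)
    have "\<forall>\<^sub>F x in nhds h. sgn x = sgn h"
    proof -
      have "\<forall>\<^sub>F x in nhds h. x \<in> ball h \<bar>h\<bar>" using False by (intro eventually_nhds_ball) simp
      then show ?thesis by eventually_elim (auto simp: dist_real_def sgn_if)
    qed
    then have ev: "\<forall>\<^sub>F x in nhds h. Y x = sgn h * sqrt (2 * V x)"
      by eventually_elim (simp add: Y_def)
    have "((\<lambda>x. sgn h * sqrt (2 * V x)) has_real_derivative Y' h) (at h)"
      using DERIV_cmult[OF s, of "sgn h"] False by (auto simp: Y'_def Y_def sgn_if)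
    then show ?thesis using DERIV_cong_ev[OF refl ev refl] by simp
  qed
  have contY: "isCont Y h" for h using dY DERIV_isCont by blast
  have contY': "isCont Y' h" for h
  proof (cases "h = 0")
    case True
    have "((\<lambda>h. (F h / h) / (Y h / h)) \<longlongrightarrow> k / sqrt k) (at 0)"
      by (intro tendsto_divide limF limY) (use k in auto)
    then have "((\<lambda>h. (F h / h) / (Y h / h)) \<longlongrightarrow> sqrt k) (at 0)"
      using k by (simp only: real_div_sqrt less_imp_le)
    then have "(Y' \<longlongrightarrow> sqrt k) (at 0)"
      by (rule Lim_transform_eventually)
         (use k in \<open>auto simp: eventually_at_filter Y'_def real_div_sqrt\<close>)
    then show ?thesis using True k by (simp add: isCont_def Y'_def real_div_sqrt)
  next
    case False
    have "isCont (\<lambda>h. F h / Y h) h"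
      using contF contY Yne[OF False] by (auto intro!: continuous_intros simp: continuous_on_eq_continuous_at)
    moreover have "\<forall>\<^sub>F x in nhds h. F x / Y x = Y' x"
      using t1_space_nhds[OF False] by eventually_elim (simp add: Y'_def)
    ultimately show ?thesis by (rule isCont_cong[THEN iffD1, rotated])
  qed
  have monoY: "strict_mono Y"
    by (rule strict_monoI) (meson DERIV_pos_imp_increasing dY Y'pos)
  define b where "b = min (Y d) (- Y (- d)) / 2"
  have b: "b > 0" "b < Y d" "Y (- d) < - b"
    using strict_monoD[OF monoY, of 0 d] strict_monoD[OF monoY, of "-d" 0] d Y0 by (auto simp: b_def)
  define W where "W = inv Y"
  have WY: "W (Y h) = h" for h
    using monoY strict_mono_imp_inj_on by (metis W_def inv_f_f)
  have ex: "\<exists>h. \<bar>h\<bar> < d \<and> Y h = y" if "Y (- d) < y" "y < Y d" for y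
  proof -
    have "\<exists>h. - d \<le> h \<and> h \<le> d \<and> Y h = y"
      by (rule IVT) (use that d contY in auto)
    then obtain h where h: "- d \<le> h" "h \<le> d" "Y h = y" by blast
    then have "h \<noteq> d" "h \<noteq> - d" using that by auto
    with h have "\<bar>h\<bar> < d" by linarith
    with h show ?thesis by blast
  qed
  have W: "\<bar>W y\<bar> < d" "Y (W y) = y" if "Y (- d) < y" "y < Y d" for y
    using ex[OF that] WY by auto
  have cW: "isCont W y" if y: "Y (- d) < y" "y < Y d" for y
  proof -
    have "isCont W (Y (W y))"
      by (rule isCont_inverse_function[of 1 "W y" W Y]) (use WY contY in auto)
    then show ?thesis using W[OF y] by simp
  qed
  have dW: "(W has_real_derivative inverse (Y' (W y))) (at y)" if y: "Y (- d) < y" "y < Y d" for y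
    by (rule DERIV_inverse_function[where f=Y and a="Y (- d)" and b="Y d"])
       (use y W cW dY less_imp_neq[OF Y'pos] in auto)
  have ran: "Y (- d) < y \<and> y < Y d" if "y \<in> {-b..b}" for y using b that by auto
  have FW: "f (u0 + W y) = F (W y)" if "y \<in> {-b..b}" for y
    using W(1)[of y] ran[OF that] by (auto simp: F_def min_def max_def)
  have "energy_chart f S b (\<lambda>y. u0 + W y) (\<lambda>y. inverse (Y' (W y)))"
  proof
    show "continuous_on {-b..b} (\<lambda>y. inverse (Y' (W y)))"
    proof (rule continuous_at_imp_continuous_on, intro ballI)
      fix y assume "y \<in> {-b..b}"
      then show "isCont (\<lambda>y. inverse (Y' (W y))) y"
        using isCont_o2[OF cW contY', of y] ran Y'pos[of "W y"]
        by (intro continuous_at_within_inverse) auto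
    qed
    show "u0 + W y \<in> S" if "y \<in> {-b..b}" for y
      using W(1)[of y] ran[OF that] inS by auto
    show "((\<lambda>y. u0 + W y) has_real_derivative inverse (Y' (W y))) (at y)" if "y \<in> {-b..b}" for y
      using dW[of y] ran[OF that] by (auto intro!: derivative_eq_intros)
    show "inverse (Y' (W y)) > 0" for y using Y'pos by simp
    show "f (u0 + W y) * inverse (Y' (W y)) = y" if "y \<in> {-b..b}" for y
    proof (cases "W y = 0")
      case True
      then have "y = 0" using W(2)[of y] ran[OF that] Y0 by auto
      then show ?thesis using True f0 by simp
    next
      case False
      then have "F (W y) \<noteq> 0" using Fpos[of "W y"] Fneg[of "W y"] by linarith
      then show ?thesis unfolding FW[OF that] using False W(2)[of y] ran[OF that]
        by (simp add: Y'_def)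
    qed
  qed (use b in auto)
  then show thesis
    by (rule that) (use WY[of 0] Y0 in \<open>auto simp: Y'_def inverse_eq_divide\<close>)
qed

section \<open>Solutions in polar coordinates and maximal extensions\<close>

text \<open>
  Conservation of the angular momentum \<open>l\<close> makes the angular component of the acceleration vanish; the
  radial one is \<open>r'' - l\<^sup>2 / r\<^sup>3\<close>.
\<close>

lemma polar_solution:
  fixes r r' \<theta> :: "real \<Rightarrow> real" and l :: real
  defines "x \<equiv> \<lambda>t. r t * cos (\<theta> t)" and "y \<equiv> \<lambda>t. r t * sin (\<theta> t)"
  assumes I: "open I" "is_interval I" "I \<noteq> {}"
    and pos: "\<And>t. t \<in> I \<Longrightarrow> r t > 0"
    and dr: "\<And>t. t \<in> I \<Longrightarrow> (r has_real_derivative r' t) (at t)"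
    and ddr: "\<And>t. t \<in> I \<Longrightarrow>
      (r' has_real_derivative l\<^sup>2 / (r t)^3 - \<phi> ((r t)\<^sup>2) * r t) (at t)"
    and d\<theta>: "\<And>t. t \<in> I \<Longrightarrow> (\<theta> has_real_derivative l / (r t)\<^sup>2) (at t)"
  shows "solution_on \<phi> I x y"
    and "\<And>t. t \<in> I \<Longrightarrow> deriv x t = r' t * cos (\<theta> t) - l / r t * sin (\<theta> t)"
    and "\<And>t. t \<in> I \<Longrightarrow> deriv y t = r' t * sin (\<theta> t) + l / r t * cos (\<theta> t)"
proof -
  define x1 where "x1 t = r' t * cos (\<theta> t) - l / r t * sin (\<theta> t)" for t
  define y1 where "y1 t = r' t * sin (\<theta> t) + l / r t * cos (\<theta> t)" for t
  have dx: "(x has_real_derivative x1 t) (at t)" if "t \<in> I" for t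
    unfolding x_def x1_def using pos[OF that]
    by (auto intro!: derivative_eq_intros dr d\<theta> that simp: field_simps power2_eq_square)
  have dy: "(y has_real_derivative y1 t) (at t)" if "t \<in> I" for t
    unfolding y_def y1_def using pos[OF that]
    by (auto intro!: derivative_eq_intros dr d\<theta> that simp: field_simps power2_eq_square)
  show ex: "deriv x t = r' t * cos (\<theta> t) - l / r t * sin (\<theta> t)"
    and ey: "deriv y t = r' t * sin (\<theta> t) + l / r t * cos (\<theta> t)" if "t \<in> I" for t
    using DERIV_imp_deriv[OF dx[OF that]] DERIV_imp_deriv[OF dy[OF that]]
    by (simp_all add: x1_def y1_def)
  have n: "(x t)\<^sup>2 + (y t)\<^sup>2 = (r t)\<^sup>2" for t
    by (simp add: x_def y_def power_mult_distrib flip: distrib_left)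
  have ev: "\<forall>\<^sub>F s in nhds t. s \<in> I" if "t \<in> I" for t
    using I(1) that by (rule eventually_nhds_in_open)
  have ddx: "(deriv x has_real_derivative - \<phi> ((x t)\<^sup>2 + (y t)\<^sup>2) * x t) (at t)" if "t \<in> I" for t
  proof -
    have "(x1 has_real_derivative - \<phi> ((r t)\<^sup>2) * x t) (at t)"
      unfolding x1_def x_def using pos[OF that]
      by (auto intro!: derivative_eq_intros dr ddr d\<theta> that
          simp: field_simps power2_eq_square power3_eq_cube)
    moreover have "\<forall>\<^sub>F s in nhds t. deriv x s = x1 s"
      using ev[OF that] by eventually_elim (simp add: ex x1_def)
    ultimately show ?thesis
      unfolding n using DERIV_cong_ev[OF refl _ refl] by blast
  qed
  have ddy: "(deriv y has_real_derivative - \<phi> ((x t)\<^sup>2 + (y t)\<^sup>2) * y t) (at t)" if "t \<in> I" for t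
  proof -
    have "(y1 has_real_derivative - \<phi> ((r t)\<^sup>2) * y t) (at t)"
      unfolding y1_def y_def using pos[OF that]
      by (auto intro!: derivative_eq_intros dr ddr d\<theta> that
          simp: field_simps power2_eq_square power3_eq_cube)
    moreover have "\<forall>\<^sub>F s in nhds t. deriv y s = y1 s"
      using ev[OF that] by eventually_elim (simp add: ey y1_def)
    ultimately show ?thesis
      unfolding n using DERIV_cong_ev[OF refl _ refl] by blast
  qed
  have nz: "(x t, y t) \<noteq> (0, 0)" if "t \<in> I" for t
    using n[of t] pos[OF that] by auto
  show "solution_on \<phi> I x y"
    unfolding solution_on_def using I nz dx dy ddx ddy
    by (auto simp: real_differentiable_def)
qed

lemma solution_on_local:
  assumes "open J" "is_interval J" "J \<noteq> {}"
    and loc: "\<And>t. t \<in> J \<Longrightarrow> \<exists>K p q. solution_on \<phi> K p q \<and> t \<in> K \<and> (\<forall>s\<in>K. u s = p s \<and> v s = q s)"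
  shows "solution_on \<phi> J u v"
  unfolding solution_on_def
proof (intro conjI ballI assms(1-3))
  fix t assume "t \<in> J"
  then obtain K p q where K: "solution_on \<phi> K p q" "t \<in> K" "\<forall>s\<in>K. u s = p s \<and> v s = q s"
    using loc by blast
  have ev: "\<forall>\<^sub>F s in nhds t. s \<in> K"
    using K(1,2) by (auto simp: solution_on_def intro: eventually_nhds_in_open)
  have e: "\<forall>\<^sub>F s in nhds t. u s = p s" "\<forall>\<^sub>F s in nhds t. v s = q s"
    using ev K(3) by (auto elim: eventually_mono)
  have de: "\<forall>\<^sub>F s in nhds t. deriv u s = deriv p s" "\<forall>\<^sub>F s in nhds t. deriv v s = deriv q s"
    using e(1)[THEN eventually_eventually[THEN iffD2]] e(2)[THEN eventually_eventually[THEN iffD2]]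
    by (eventually_elim; simp add: deriv_cong_ev)+
  note s = K(1)[unfolded solution_on_def, THEN conjunct2, THEN conjunct2, THEN conjunct2, THEN bspec, OF K(2)]
  have eq: "u t = p t" "v t = q t" using K by auto
  show "(u t, v t) \<noteq> (0, 0)" using s eq by simp
  show "u differentiable at t" "v differentiable at t"
    using s DERIV_cong_ev[OF refl e(1) refl] DERIV_cong_ev[OF refl e(2) refl]
    by (auto simp: real_differentiable_def)
  show "(deriv u has_real_derivative - \<phi> ((u t)\<^sup>2 + (v t)\<^sup>2) * u t) (at t)"
    "(deriv v has_real_derivative - \<phi> ((u t)\<^sup>2 + (v t)\<^sup>2) * v t) (at t)"
    using s eq DERIV_cong_ev[OF refl de(1) refl] DERIV_cong_ev[OF refl de(2) refl] by simp_all
qed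

text \<open>
  Zorn's lemma for the graphs of solutions, ordered by inclusion: the union of a chain is again the
  graph of a solution because being a solution is a local property.
\<close>

lemma maximal_extension:
  assumes sol: "solution_on \<phi> I x y"
  obtains J u v where "maximal_solution \<phi> J u v" "I \<subseteq> J" "\<And>t. t \<in> I \<Longrightarrow> u t = x t \<and> v t = y t"
proof -
  define gr :: "real set \<Rightarrow> (real \<Rightarrow> real) \<Rightarrow> (real \<Rightarrow> real) \<Rightarrow> (real \<times> real \<times> real) set"
    where "gr J u v = (\<lambda>t. (t, u t, v t)) ` J" for J u v
  define F where "F = {gr J u v | J u v. solution_on \<phi> J u v \<and> gr I x y \<subseteq> gr J u v}"
  have mem: "(t, a, b) \<in> gr J u v \<longleftrightarrow> t \<in> J \<and> a = u t \<and> b = v t" for t a b J u v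
    by (auto simp: gr_def)
  have sub: "gr J u v \<subseteq> gr K p q \<longleftrightarrow> J \<subseteq> K \<and> (\<forall>t\<in>J. p t = u t \<and> q t = v t)" for J u v K p q
    by (auto simp: gr_def)
  have "\<exists>M\<in>F. \<forall>X\<in>F. M \<subseteq> X \<longrightarrow> X = M"
  proof (rule subset_Zorn_nonempty)
    show "F \<noteq> {}" using sol by (auto simp: F_def)
    fix C assume C: "C \<noteq> {}" "subset.chain F C"
    then have CF: "\<And>X. X \<in> C \<Longrightarrow> X \<in> F" and tot: "\<And>X Y. X \<in> C \<Longrightarrow> Y \<in> C \<Longrightarrow> X \<subseteq> Y \<or> Y \<subseteq> X"
      by (auto simp: subset_chain_def)
    define J where "J = fst ` \<Union>C"
    have fn: "a = a' \<and> b = b'" if ab: "(t, a, b) \<in> \<Union>C" and ab': "(t, a', b') \<in> \<Union>C" for t a b a' b'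
    proof -
      from ab ab' obtain X where "X \<in> C" "(t, a, b) \<in> X" "(t, a', b') \<in> X"
        by (meson UnionE subsetD tot)
      then show ?thesis using CF[of X] by (auto simp: F_def mem)
    qed
    define w where "w t = (SOME ab. (t, ab) \<in> \<Union>C)" for t
    define u v where "u t = fst (w t)" and "v t = snd (w t)" for t
    have uv: "u t = a \<and> v t = b" if "(t, a, b) \<in> \<Union>C" for t a b
    proof -
      have "(t, w t) \<in> \<Union>C" unfolding w_def using that by (rule someI)
      then show ?thesis using fn[OF _ that, of "u t" "v t"] by (simp add: u_def v_def)
    qed
    have UC: "\<Union>C = gr J u v"
    proof (intro set_eqI iffI)
      fix z assume z: "z \<in> \<Union>C"
      obtain t a b where zz: "z = (t, a, b)" using prod_cases3 by blast
      from z have "t \<in> J" unfolding J_def zz by force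
      with uv[of t a b] z show "z \<in> gr J u v" by (simp add: mem zz)
    next
      fix z assume "z \<in> gr J u v"
      then obtain t where t: "t \<in> J" "z = (t, u t, v t)" by (auto simp: gr_def)
      then obtain a b where "(t, a, b) \<in> \<Union>C" unfolding J_def by force
      with uv[OF this] t show "z \<in> \<Union>C" by simp
    qed
    have piece: "\<exists>K p q. X = gr K p q \<and> solution_on \<phi> K p q \<and> K \<subseteq> J \<and> (\<forall>s\<in>K. u s = p s \<and> v s = q s)"
      if "X \<in> C" for X
    proof -
      obtain K p q where K: "X = gr K p q" "solution_on \<phi> K p q"
        using CF[OF \<open>X \<in> C\<close>] by (auto simp: F_def)
      have "gr K p q \<subseteq> gr J u v" using that UC K(1) by blast
      then have "K \<subseteq> J" "\<forall>s\<in>K. u s = p s \<and> v s = q s" unfolding sub by simp_all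
      with K show ?thesis by blast
    qed
    have pt: "\<exists>X\<in>C. (t, u t, v t) \<in> X" if "t \<in> J" for t
      using that UC mem[of t "u t" "v t" J u v] by blast
    have "solution_on \<phi> J u v"
    proof (rule solution_on_local)
      show loc: "\<exists>K p q. solution_on \<phi> K p q \<and> t \<in> K \<and> (\<forall>s\<in>K. u s = p s \<and> v s = q s)"
        if "t \<in> J" for t
      proof -
        obtain X where X: "X \<in> C" "(t, u t, v t) \<in> X" using pt[OF \<open>t \<in> J\<close>] by blast
        from piece[OF X(1)] obtain K p q where "X = gr K p q" "solution_on \<phi> K p q"
          "\<forall>s\<in>K. u s = p s \<and> v s = q s" by blast
        moreover from this X(2) have "t \<in> K" by (simp add: mem)
        ultimately show ?thesis by blast
      qed
      show "open J"
      proof (rule Topological_Spaces.openI)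
        fix t assume "t \<in> J"
        then obtain X where X: "X \<in> C" "(t, u t, v t) \<in> X" using pt by blast
        from piece[OF X(1)] obtain K p q where "X = gr K p q" "open K" "K \<subseteq> J"
          unfolding solution_on_def by blast
        moreover from this X(2) have "t \<in> K" by (simp add: mem)
        ultimately show "\<exists>T. open T \<and> t \<in> T \<and> T \<subseteq> J" by blast
      qed
      show "is_interval J"
        unfolding is_interval_1
      proof (intro ballI allI impI)
        fix a b t assume "a \<in> J" "b \<in> J" and t: "a \<le> t \<and> t \<le> b"
        then obtain X where X: "X \<in> C" "(a, u a, v a) \<in> X" "(b, u b, v b) \<in> X"
          by (meson pt subsetD tot)
        from piece[OF X(1)] obtain K p q where K': "X = gr K p q" "solution_on \<phi> K p q" "K \<subseteq> J"
          by blast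
        with X(2,3) have K: "solution_on \<phi> K p q" "K \<subseteq> J" "a \<in> K" "b \<in> K"
          by (auto simp: mem)
        then have "t \<in> K" using t unfolding solution_on_def is_interval_1 by blast
        then show "t \<in> J" using K by blast
      qed
      obtain X where "X \<in> C" using C by blast
      with piece[OF this] show "J \<noteq> {}" unfolding solution_on_def by blast
    qed
    moreover have "gr I x y \<subseteq> gr J u v"
      using C(1) CF UC by (auto simp: F_def)
    ultimately show "\<Union>C \<in> F" unfolding UC F_def by blast
  qed
  then obtain J u v where M: "solution_on \<phi> J u v" "gr I x y \<subseteq> gr J u v"
    and mx: "\<And>X. X \<in> F \<Longrightarrow> gr J u v \<subseteq> X \<Longrightarrow> X = gr J u v"
    by (auto simp: F_def)
  have "maximal_solution \<phi> J u v"
    unfolding maximal_solution_def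
  proof (intro conjI M(1) allI impI, elim conjE)
    fix K p q assume K: "solution_on \<phi> K p q" "J \<subseteq> K" "\<forall>t\<in>J. p t = u t \<and> q t = v t"
    then have s: "gr J u v \<subseteq> gr K p q" using sub by blast
    moreover have "gr K p q \<in> F" using K(1) order_trans[OF M(2) s] unfolding F_def by blast
    ultimately have "gr K p q = gr J u v" using mx by blast
    then have "gr K p q \<subseteq> gr J u v" by simp
    then show "K = J" using K(2) unfolding sub by blast
  qed
  moreover have "I \<subseteq> J" "\<And>t. t \<in> I \<Longrightarrow> u t = x t \<and> v t = y t"
    using M(2) unfolding sub by auto
  ultimately show thesis by (rule that)
qed

section \<open>Binet's equation\<close>

text \<open>
  The restoring force in Binet's equation. Its positive zeros are the reciprocal radii of
  the circular motions with angular momentum \<open>l\<close>.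
\<close>

abbreviation binet_force :: "(real \<Rightarrow> real) \<Rightarrow> real \<Rightarrow> real \<Rightarrow> real" where
  "binet_force \<phi> l u \<equiv> u - \<phi> (1 / u\<^sup>2) / (l\<^sup>2 * u^3)"

text \<open>
  As a function of the polar angle \<open>\<theta>\<close>, the reciprocal radius of a motion with angular momentum \<open>l\<close>
  satisfies Binet's equation \<open>u'' = - binet_force \<phi> l u\<close>. Here a solution \<open>w\<close> of it, parametrised by
  \<open>s\<close> with \<open>d\<theta> = q ds\<close> and \<open>z = dw/d\<theta>\<close>, is turned into a planar motion: since \<open>d\<theta>/dt = l * w\<^sup>2\<close>, time
  elapses at the rate \<open>q / (l * w\<^sup>2)\<close>, and in time the radius \<open>1 / w\<close> has velocity \<open>- l * z\<close>. The equation
  is required only on \<open>D\<close>; the clock runs on the whole line so that its inverse is total.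
\<close>

lemma solution_of_binet_curve:
  fixes l :: real and w z q :: "real \<Rightarrow> real"
  assumes l: "l > 0" and D: "open D" "is_interval D" "0 \<in> D"
    and cont: "continuous_on UNIV q" "continuous_on UNIV w"
    and wpos: "\<And>s. w s > 0"
    and c: "c > 0" "\<And>s. c \<le> q s / (w s)\<^sup>2"
    and dw: "\<And>s. s \<in> D \<Longrightarrow> (w has_real_derivative q s * z s) (at s)"
    and dz: "\<And>s. s \<in> D \<Longrightarrow>
      (z has_real_derivative - (q s * binet_force \<phi> l (w s))) (at s)"
  obtains \<tau> \<Theta> x y where
    "\<tau> 0 = 0" "strict_mono \<tau>" "surj \<tau>"
    "\<Theta> 0 = 0" "\<And>s. (\<Theta> has_real_derivative q s) (at s)"
    "\<And>t. x t = cos (\<Theta> (\<tau> t)) / w (\<tau> t)" "\<And>t. y t = sin (\<Theta> (\<tau> t)) / w (\<tau> t)"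
    "solution_on \<phi> {t. \<tau> t \<in> D} x y"
    "phase_point x y 0 = (Complex (1 / w 0) 0, Complex (- l * z 0) (l * w 0))"
proof -
  have qpos: "q s > 0" for s
    using c(1) c(2)[of s] wpos[of s] by (smt (verit) divide_nonpos_nonneg zero_le_power2)
  have wne: "w s \<noteq> 0" for s using wpos[of s] by simp
  have pe: "q s / (l * (w s)\<^sup>2) = q s / (w s)\<^sup>2 / l" for s by (simp add: field_simps)
  obtain \<tau> where \<tau>: "\<tau> 0 = 0" "strict_mono \<tau>" "surj \<tau>"
    "\<And>t. (\<tau> has_real_derivative 1 / (q (\<tau> t) / (l * (w (\<tau> t))\<^sup>2))) (at t)"
  proof (rule time_change[of "\<lambda>s. q s / (l * (w s)\<^sup>2)" "c / l"])
    show "continuous_on UNIV (\<lambda>s. q s / (l * (w s)\<^sup>2))"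
      using l wne by (intro continuous_intros cont) auto
    show "c / l \<le> q s / (l * (w s)\<^sup>2)" for s
      unfolding pe using l c by (intro divide_right_mono) auto
  qed (use c l in auto)
  obtain \<Theta> where \<Theta>: "\<Theta> 0 = 0" "\<And>s. (\<Theta> has_real_derivative q s) (at s)"
    using antiderivative_on_line[OF cont(1)] by blast
  define r where "r t = 1 / w (\<tau> t)" for t
  define r' where "r' t = - l * z (\<tau> t)" for t
  define \<theta> where "\<theta> t = \<Theta> (\<tau> t)" for t
  define I where "I = {t. \<tau> t \<in> D}"
  have n0: "w s \<noteq> 0" "q s \<noteq> 0" for s using wpos[of s] qpos[of s] by auto
  have ct: "continuous_on UNIV \<tau>"
    using \<tau>(4) by (rule continuous_on_of_DERIV)
  have oI: "open I"
    using open_vimage[OF D(1) ct] by (simp add: I_def vimage_def)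
  have iI: "is_interval I"
    using D(2) strict_mono_less_eq[OF \<tau>(2)] unfolding is_interval_1 I_def by blast
  have I0: "0 \<in> I" using D(3) \<tau>(1) by (simp add: I_def)
  have d\<tau>: "(\<tau> has_real_derivative l * (w (\<tau> t))\<^sup>2 / q (\<tau> t)) (at t)" for t
    using \<tau>(4)[of t] by simp
  have dr: "(r has_real_derivative r' t) (at t)" if "t \<in> I" for t
  proof -
    have "((\<lambda>t. w (\<tau> t)) has_real_derivative q (\<tau> t) * z (\<tau> t) * (l * (w (\<tau> t))\<^sup>2 / q (\<tau> t))) (at t)"
      by (rule DERIV_chain2[OF dw d\<tau>]) (use that in \<open>simp add: I_def\<close>)
    then show ?thesis unfolding r_def r'_def using n0
      by (auto intro!: derivative_eq_intros simp: field_simps power2_eq_square)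
  qed
  have ddr: "(r' has_real_derivative l\<^sup>2 / (r t)^3 - \<phi> ((r t)\<^sup>2) * r t) (at t)" if "t \<in> I" for t
  proof -
    have "((\<lambda>t. z (\<tau> t)) has_real_derivative
      - (q (\<tau> t) * (w (\<tau> t) - \<phi> (1 / (w (\<tau> t))\<^sup>2) / (l\<^sup>2 * (w (\<tau> t))^3))) * (l * (w (\<tau> t))\<^sup>2 / q (\<tau> t))) (at t)"
      by (rule DERIV_chain2[OF dz d\<tau>]) (use that in \<open>simp add: I_def\<close>)
    then have dr': "(r' has_real_derivative - l *
      (- (q (\<tau> t) * (w (\<tau> t) - \<phi> (1 / (w (\<tau> t))\<^sup>2) / (l\<^sup>2 * (w (\<tau> t))^3))) * (l * (w (\<tau> t))\<^sup>2 / q (\<tau> t)))) (at t)"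
      unfolding r'_def by (rule DERIV_cmult)
    have alg: "- l * (- (Q * (W - F / (l\<^sup>2 * W^3))) * (l * W\<^sup>2 / Q)) = l\<^sup>2 / (1/W)^3 - F * (1 / W)"
      if "W \<noteq> 0" "Q \<noteq> 0" for W Q F :: real
      using that l by (simp add: field_simps power2_eq_square power3_eq_cube)
    have "(1 / w (\<tau> t))\<^sup>2 = 1 / (w (\<tau> t))\<^sup>2" by (simp add: power_one_over)
    then show ?thesis
      using dr' unfolding alg[OF n0] r_def by simp
  qed
  have d\<theta>: "(\<theta> has_real_derivative l / (r t)\<^sup>2) (at t)" for t
  proof -
    have "(\<theta> has_real_derivative q (\<tau> t) * (l * (w (\<tau> t))\<^sup>2 / q (\<tau> t))) (at t)"
      unfolding \<theta>_def by (rule DERIV_chain2[OF \<Theta>(2) d\<tau>])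
    then show ?thesis using n0 by (simp add: r_def power_one_over)
  qed
  have rp: "r t > 0" for t using wpos by (simp add: r_def)
  note pol = polar_solution[where r=r and r'=r' and \<theta>=\<theta> and l=l and \<phi>=\<phi> and I=I,
      OF oI iI _ rp dr ddr d\<theta>]
  have "phase_point (\<lambda>t. r t * cos (\<theta> t)) (\<lambda>t. r t * sin (\<theta> t)) 0 =
      (Complex (1 / w 0) 0, Complex (- l * z 0) (l * w 0))"
    using pol(2,3)[of 0] I0 \<tau>(1) \<Theta>(1)
    by (auto simp: phase_point_def r_def r'_def \<theta>_def)
  moreover have "solution_on \<phi> I (\<lambda>t. r t * cos (\<theta> t)) (\<lambda>t. r t * sin (\<theta> t))"
    using pol(1) I0 by auto
  ultimately show thesis
    by (intro that[OF \<tau>(1-3) \<Theta>, of "\<lambda>t. r t * cos (\<theta> t)" "\<lambda>t. r t * sin (\<theta> t)"])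
       (auto simp: r_def \<theta>_def I_def)
qed

text \<open>
  A usable form of the periodicity hypothesis: by maximal extension it also constrains motions that
  are known only on part of their interval of existence. Here \<open>u\<close> is the reciprocal radius of the
  circular motion and \<open>l\<close> its angular momentum.
\<close>

lemma periodic_near_circular_orbit:
  fixes u l :: real
  assumes per: "all_solutions_near_circular_motions_periodic \<phi>"
    and u: "u > 0" and l: "l > 0" and \<phi>: "\<phi> (1 / u\<^sup>2) = l\<^sup>2 * u^4"
  obtains W where "open W" "(Complex (1 / u) 0, Complex 0 (l * u)) \<in> W"
    "\<And>I x y. solution_on \<phi> I x y \<Longrightarrow> 0 \<in> I \<Longrightarrow> phase_point x y 0 \<in> W \<Longrightarrow>
       \<exists>T>0. \<forall>t\<in>I. t + T \<in> I \<longrightarrow> x (t + T) = x t \<and> y (t + T) = y t"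
proof -
  define w where "w = l * u\<^sup>2"
  define X Y where "X t = cos (w * t) / u" and "Y t = sin (w * t) / u" for t
  have z: "Complex (X t) (Y t) = of_real (1 / u) * 1 * cis (w * t)" for t
    by (simp add: complex_eq_iff X_def Y_def)
  have w: "w \<noteq> 0" "w\<^sup>2 = \<phi> ((1 / u)\<^sup>2)" "\<phi> ((1 / u)\<^sup>2) > 0"
    using u l \<phi> by (auto simp: w_def power_one_over power_mult_distrib)
  have "circular_motion \<phi> UNIV X Y"
    unfolding circular_motion_iff using u w z
    by (intro conjI exI[of _ "1 / u"] exI[of _ 1] exI[of _ w]) auto
  then obtain W where W: "open W" "orbit UNIV X Y \<subseteq> W"
    and Wp: "\<And>J x y. maximal_solution \<phi> J x y \<Longrightarrow> 0 \<in> J \<Longrightarrow> phase_point x y 0 \<in> W \<Longrightarrow> periodic_motion J x y"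
    using per unfolding all_solutions_near_circular_motions_periodic_def by metis
  have "(Complex (1 / u) 0, Complex 0 (l * u)) \<in> orbit UNIV X Y"
    unfolding circular_motion_orbit[OF w(1) _ z, simplified]
    using u by (auto intro!: exI[of _ 1] simp: complex_eq_iff w_def power2_eq_square)
  with W(2) have "(Complex (1 / u) 0, Complex 0 (l * u)) \<in> W" by blast
  moreover have "\<exists>T>0. \<forall>t\<in>I. t + T \<in> I \<longrightarrow> x (t + T) = x t \<and> y (t + T) = y t"
    if sol: "solution_on \<phi> I x y" and I0: "0 \<in> I" and p: "phase_point x y 0 \<in> W" for I x y
  proof -
    obtain J a b where J: "maximal_solution \<phi> J a b" "I \<subseteq> J" and ab: "\<And>t. t \<in> I \<Longrightarrow> a t = x t \<and> b t = y t"
      using maximal_extension[OF sol] by blast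
    have "\<forall>\<^sub>F t in nhds 0. t \<in> I"
      using sol I0 by (auto simp: solution_on_def intro: eventually_nhds_in_open)
    then have "\<forall>\<^sub>F t in nhds 0. a t = x t" "\<forall>\<^sub>F t in nhds 0. b t = y t"
      using ab by (auto elim: eventually_mono)
    then have "deriv a 0 = deriv x 0" "deriv b 0 = deriv y 0" by (auto intro: deriv_cong_ev)
    then have "phase_point a b 0 = phase_point x y 0"
      using ab[OF I0] by (simp add: phase_point_def)
    then have "periodic_motion J a b" using Wp J I0 p by auto
    then show ?thesis unfolding periodic_motion_def using ab by metis
  qed
  ultimately show thesis using that W(1) by blast
qed

section \<open>Motions near a circular motion\<close>

text \<open>
  In the energy coordinate the motions near a stable circular one are explicit,
  \<open>u = U (a * sin s)\<close>, and the angle swept during one radial oscillation is the integral below. If the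
  motion is periodic, a period consists of \<open>n > 0\<close> radial oscillations, after which the angle has
  advanced by \<open>2 * pi * m\<close>.
\<close>

lemma apsidal_angle_rational:
  fixes l :: real
  assumes per: "all_solutions_near_circular_motions_periodic \<phi>" and l: "l > 0"
    and circ: "\<phi> (1 / (U 0)\<^sup>2) = l\<^sup>2 * (U 0)^4"
    and chart: "energy_chart (binet_force \<phi> l) {0<..} b U U'"
  obtains a0 where "0 < a0" "a0 \<le> b"
    "\<And>a. 0 < a \<Longrightarrow> a < a0 \<Longrightarrow> integral {0..2*pi} (\<lambda>s. U' (a * sin s)) / (2 * pi) \<in> \<rat>"
proof -
  interpret energy_chart "binet_force \<phi> l" "{0<..}" b U U' by (fact chart)
  have Upos: "U y > 0" if "y \<in> {-b..b}" for y using U_mem[OF that] by simp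
  obtain W where W: "open W" "(Complex (1 / U 0) 0, Complex 0 (l * U 0)) \<in> W"
    and WP: "\<And>I x y. solution_on \<phi> I x y \<Longrightarrow> 0 \<in> I \<Longrightarrow> phase_point x y 0 \<in> W \<Longrightarrow>
       \<exists>T>0. \<forall>t\<in>I. t + T \<in> I \<longrightarrow> x (t + T) = x t \<and> y (t + T) = y t"
    using periodic_near_circular_orbit[OF per _ l circ] Upos[of 0] b by auto
  have "((\<lambda>a. (Complex (1 / U 0) 0, Complex (- l * a) (l * U 0))) \<longlongrightarrow>
      (Complex (1 / U 0) 0, Complex (- l * 0) (l * U 0))) (at_right 0)"
    by (intro tendsto_intros)
  then have "\<forall>\<^sub>F a in at_right 0. (Complex (1 / U 0) 0, Complex (- l * a) (l * U 0)) \<in> W"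
    using W by (auto dest: topological_tendstoD)
  then obtain a1 where a1: "a1 > 0"
    "\<And>a. 0 < a \<Longrightarrow> a < a1 \<Longrightarrow> (Complex (1 / U 0) 0, Complex (- l * a) (l * U 0)) \<in> W"
    unfolding eventually_at_right_field by auto
  obtain c where c: "c > 0" "\<And>y. y \<in> {-b..b} \<Longrightarrow> c \<le> U' y / (U y)\<^sup>2"
    using clock_rate_bound[of thesis] by auto
  show thesis
  proof (rule that[of "min a1 b"])
    fix a :: real assume a: "0 < a" "a < min a1 b"
    have ran: "a * sin s \<in> {-b..b}" for s
    proof -
      have "\<bar>a * sin s\<bar> \<le> a" using a(1) by (simp add: abs_mult)
      then show ?thesis using a(2) by auto
    qed
    define w where "w s = U (a * sin s)" for s
    define q where "q s = U' (a * sin s)" for s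
    have cq: "continuous_on A q" for A
      unfolding q_def
      by (rule continuous_on_compose2[OF cont_U']) (use ran in \<open>auto intro!: continuous_intros\<close>)
    have cw: "continuous_on A w" for A
      unfolding w_def
      by (rule continuous_on_compose2[OF cont_U]) (use ran in \<open>auto intro!: continuous_intros\<close>)
    have dw: "(w has_real_derivative q s * (a * cos s)) (at s)" for s
      unfolding w_def q_def
      by (rule DERIV_chain2[where g="\<lambda>s. a * sin s", OF DERIV_U[OF ran[of s]]]) (auto intro!: derivative_eq_intros)
    have dz: "((\<lambda>s. a * cos s) has_real_derivative
        - (q s * binet_force \<phi> l (w s))) (at s)" for s
      using energy[OF ran[of s]]
      by (auto intro!: derivative_eq_intros simp: w_def q_def mult.commute)
    have wpos: "w s > 0" for s using Upos[OF ran] by (simp add: w_def)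
    have cb: "c \<le> q s / (w s)\<^sup>2" for s using c(2)[OF ran] by (simp add: w_def q_def)
    obtain \<tau> \<Theta> x y where \<tau>: "\<tau> 0 = 0" "strict_mono \<tau>" "surj \<tau>"
      and \<Theta>: "\<Theta> 0 = 0" "\<And>s. (\<Theta> has_real_derivative q s) (at s)"
      and x: "\<And>t. x t = cos (\<Theta> (\<tau> t)) / w (\<tau> t)" and y: "\<And>t. y t = sin (\<Theta> (\<tau> t)) / w (\<tau> t)"
      and sol: "solution_on \<phi> {t. \<tau> t \<in> UNIV} x y"
      and p0: "phase_point x y 0 = (Complex (1 / w 0) 0, Complex (- l * (a * cos 0)) (l * w 0))"
      by (rule solution_of_binet_curve[where l=l and D=UNIV and q=q and w=w and z="\<lambda>s. a * cos s" and c=c and \<phi>=\<phi>])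
         (use l cq cw c(1) cb wpos dw dz in auto)
    have "phase_point x y 0 \<in> W" using p0 a a1(2)[of a] by (simp add: w_def)
    then obtain T where T: "T > 0" "\<And>t. x (t + T) = x t \<and> y (t + T) = y t"
      using WP[OF sol] by auto
    have rad: "(x t)\<^sup>2 + (y t)\<^sup>2 = (1 / w (\<tau> t))\<^sup>2" for t
      by (simp add: x y power_divide flip: add_divide_distrib)
    \<comment> \<open>Start the observation at a pericentre, where the energy coordinate is maximal.\<close>
    obtain t where t: "\<tau> t = pi / 2" using \<tau>(3) by (metis surjD)
    define \<sigma> where "\<sigma> = \<tau> (t + T)"
    have \<sigma>: "\<sigma> > pi / 2" unfolding \<sigma>_def t[symmetric] using \<tau>(2) T(1) by (simp add: strict_monoD)
    have "(1 / w \<sigma>)\<^sup>2 = (1 / w (pi / 2))\<^sup>2"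
      using rad[of t] rad[of "t + T"] T(2)[of t] by (simp add: \<sigma>_def t)
    then have weq: "w \<sigma> = w (pi / 2)"
      using wpos[of \<sigma>] wpos[of "pi / 2"] by (simp add: power_divide power2_eq_iff_nonneg)
    have "\<not> a * sin \<sigma> < a * sin (pi / 2)"
      using U_less[of "a * sin \<sigma>" "a * sin (pi / 2)"] weq ran[of \<sigma>] ran[of "pi / 2"] by (auto simp: w_def)
    then have "sin \<sigma> = 1" using a(1) by (smt (verit) mult_less_cancel_left_pos sin_le_one sin_pi_half)
    moreover from this have "cos \<sigma> = 0" using sin_cos_squared_add[of \<sigma>] by simp
    ultimately obtain n :: int where n: "\<sigma> = pi / 2 + 2 * pi * n"
      using sin_cos_eq_iff[of \<sigma> "pi / 2"] by auto
    have "n > 0"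
    proof -
      have "2 * pi * real_of_int n > 0" using n \<sigma> by simp
      then show ?thesis by (simp add: zero_less_mult_iff)
    qed
    have "cos (\<Theta> \<sigma>) = cos (\<Theta> (pi / 2))" "sin (\<Theta> \<sigma>) = sin (\<Theta> (pi / 2))"
      using T(2)[of t] wpos[of "pi / 2"] unfolding x y t \<sigma>_def[symmetric] weq by auto
    then obtain m :: int where m: "\<Theta> \<sigma> = \<Theta> (pi / 2) + 2 * pi * m"
      using sin_cos_eq_iff by blast
    define P where "P = \<Theta> (2 * pi)"
    have step: "\<Theta> (s + 2 * pi) = \<Theta> s + P" for s
    proof -
      have "((\<lambda>s. \<Theta> (s + 2 * pi) - \<Theta> s) has_real_derivative q (s + 2 * pi) * 1 - q s) (at s)" for s
        by (intro DERIV_diff \<Theta>(2) DERIV_chain2[OF \<Theta>(2)]) (auto intro!: derivative_eq_intros)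
      then have "((\<lambda>s. \<Theta> (s + 2 * pi) - \<Theta> s) has_real_derivative 0) (at s)" for s
        by (simp add: q_def)
      then have "\<Theta> (s + 2 * pi) - \<Theta> s = \<Theta> (0 + 2 * pi) - \<Theta> 0"
        using DERIV_isconst_all by blast
      then show ?thesis by (simp add: P_def \<Theta>(1))
    qed
    have steps: "\<Theta> (s + 2 * pi * real j) = \<Theta> s + real j * P" for s j
    proof (induction j)
      case (Suc j)
      have "\<Theta> (s + 2 * pi * real (Suc j)) = \<Theta> ((s + 2 * pi * real j) + 2 * pi)"
        by (simp add: algebra_simps)
      then show ?case unfolding step Suc by (simp add: algebra_simps)
    qed simp
    have "real_of_int n * P = 2 * pi * m"
      using m steps[of "pi / 2" "nat n"] \<open>n > 0\<close> unfolding n by simp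
    then have "P / (2 * pi) = of_int m / of_int n"
      using \<open>n > 0\<close> by (simp add: field_simps)
    moreover have "(q has_integral (\<Theta> (2 * pi) - \<Theta> 0)) {0..2*pi}"
      by (rule fundamental_theorem_of_calculus)
         (auto simp: has_real_derivative_iff_has_vector_derivative[symmetric]
            intro: \<Theta>(2) has_field_derivative_at_within)
    then have "integral {0..2*pi} q = P" by (simp add: P_def \<Theta>(1) integral_unique)
    ultimately show "integral {0..2*pi} (\<lambda>s. U' (a * sin s)) / (2 * pi) \<in> \<rat>"
      unfolding q_def[symmetric] by simp
  qed (use a1 b in auto)
qed

text \<open>
  The apsidal angle is continuous in the amplitude, rational up to the factor \<open>2 * pi\<close>, and hence
  constant. Its value at amplitude \<open>0\<close>, the angle of the linearised oscillation, is then rational too.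
\<close>

lemma isochronous:
  fixes l :: real
  assumes per: "all_solutions_near_circular_motions_periodic \<phi>" and l: "l > 0"
    and circ: "\<phi> (1 / (U 0)\<^sup>2) = l\<^sup>2 * (U 0)^4"
    and chart: "energy_chart (binet_force \<phi> l) {0<..} b U U'"
  obtains a0 where "0 < a0" "a0 \<le> b" "U' 0 \<in> \<rat>"
    "\<And>a. 0 \<le> a \<Longrightarrow> a < a0 \<Longrightarrow> integral {0..2*pi} (\<lambda>s. U' (a * sin s)) = 2 * pi * U' 0"
proof -
  obtain a0 where a0: "0 < a0" "a0 \<le> b"
    "\<And>a. 0 < a \<Longrightarrow> a < a0 \<Longrightarrow> integral {0..2*pi} (\<lambda>s. U' (a * sin s)) / (2 * pi) \<in> \<rat>"
    using apsidal_angle_rational[OF assms] by blast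
  interpret energy_chart "binet_force \<phi> l" "{0<..}" b U U' by (fact chart)
  define R where "R a = integral {0..2*pi} (\<lambda>s. U' (a * sin s)) / (2 * pi)" for a
  have ran: "a * sin s \<in> {-b..b}" if "a \<in> {0..<a0}" for a s
  proof -
    have "\<bar>a * sin s\<bar> \<le> a" using that by (simp add: abs_mult mult_left_le)
    then show ?thesis using that a0(2) by auto
  qed
  have "continuous_on ({0..<a0} \<times> cbox 0 (2 * pi)) (\<lambda>(a, s). U' (a * sin s))"
    unfolding case_prod_beta
    by (rule continuous_on_compose2[OF cont_U']) (use ran in \<open>auto intro!: continuous_intros\<close>)
  then have "continuous_on {0..<a0} (\<lambda>a. integral (cbox 0 (2 * pi)) (\<lambda>s. U' (a * sin s)))"
    by (rule integral_continuous_on_param)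
  then have "continuous_on {0..<a0} R"
    unfolding R_def by (intro continuous_intros) auto
  moreover have "R ` {0..<a0} \<subseteq> insert (R 0) \<rat>"
    using a0(3) by (force simp: R_def less_le)
  then have "countable (R ` {0..<a0})"
    using countable_rat by (meson countable_insert countable_subset)
  ultimately have const: "R a = R 0" if "0 \<le> a" "a < a0" for a
    using constant_of_countable_range[of "{0..<a0}" R a 0] that a0(1) by simp
  have R0: "R 0 = U' 0" by (simp add: R_def)
  have "R (a0 / 2) \<in> \<rat>" using a0(3)[of "a0 / 2"] a0(1) by (simp add: R_def)
  then have "U' 0 \<in> \<rat>" using const[of "a0 / 2"] a0(1) R0 by simp
  moreover have "integral {0..2*pi} (\<lambda>s. U' (a * sin s)) = 2 * pi * U' 0" if "0 \<le> a" "a < a0" for a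
    using const[OF that] R0 by (simp add: R_def field_simps)
  ultimately show thesis using that a0 by blast
qed

text \<open>
  At an unstable circular motion the chart belongs to the reversed force, so the potential energy is
  \<open>- y\<^sup>2 / 2\<close> and the energy level of the equilibrium is \<open>u' = \<plusminus> y\<close>. It contains the solutions
  \<open>u = U (a * exp (- s))\<close>, which approach the circular motion forever. Their radius increases strictly,
  so they are not periodic. Since \<open>U\<close> is only local, the exponential is held constant for \<open>s \<le> - 1\<close>.
\<close>

lemma no_saddle:
  fixes l :: real
  assumes per: "all_solutions_near_circular_motions_periodic \<phi>" and l: "l > 0"
    and circ: "\<phi> (1 / (U 0)\<^sup>2) = l\<^sup>2 * (U 0)^4"
    and chart: "energy_chart (\<lambda>u. - binet_force \<phi> l u) {0<..} b U U'"
  shows False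
proof -
  interpret energy_chart "\<lambda>u. - binet_force \<phi> l u" "{0<..}" b U U' by (fact chart)
  have Upos: "U y > 0" if "y \<in> {-b..b}" for y using U_mem[OF that] by simp
  obtain W where W: "open W" "(Complex (1 / U 0) 0, Complex 0 (l * U 0)) \<in> W"
    and WP: "\<And>I x y. solution_on \<phi> I x y \<Longrightarrow> 0 \<in> I \<Longrightarrow> phase_point x y 0 \<in> W \<Longrightarrow>
       \<exists>T>0. \<forall>t\<in>I. t + T \<in> I \<longrightarrow> x (t + T) = x t \<and> y (t + T) = y t"
    using periodic_near_circular_orbit[OF per _ l circ] Upos[of 0] b by auto
  have U0: "(U \<longlongrightarrow> U 0) (at_right 0)"
    using DERIV_U[of 0] b DERIV_isCont isCont_def filterlim_at_split by fastforce
  have "((\<lambda>a. (Complex (1 / U a) 0, Complex (l * a) (l * U a))) \<longlongrightarrow>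
      (Complex (1 / U 0) 0, Complex (l * 0) (l * U 0))) (at_right 0)"
    by (intro tendsto_intros U0) (use Upos[of 0] b in auto)
  then have "\<forall>\<^sub>F a in at_right 0. (Complex (1 / U a) 0, Complex (l * a) (l * U a)) \<in> W"
    using W by (auto dest: topological_tendstoD)
  then obtain a1 where a1: "a1 > 0"
    "\<And>a. 0 < a \<Longrightarrow> a < a1 \<Longrightarrow> (Complex (1 / U a) 0, Complex (l * a) (l * U a)) \<in> W"
    unfolding eventually_at_right_field by auto
  obtain c where c: "c > 0" "\<And>y. y \<in> {-b..b} \<Longrightarrow> c \<le> U' y / (U y)\<^sup>2"
    using clock_rate_bound[of thesis] by auto
  define a where "a = min a1 (b / exp 1) / 2"
  have a: "0 < a" "a < a1" "a * exp 1 < b"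
    using a1(1) b by (auto simp: a_def min_def field_simps)
  define Y where "Y s = a * exp (- max s (- 1))" for s :: real
  have Yran: "Y s \<in> {-b..b}" for s
  proof -
    have "Y s \<le> a * exp 1" using a(1) by (simp add: Y_def)
    moreover have "Y s \<ge> 0" using a(1) by (simp add: Y_def)
    ultimately show ?thesis using a(3) b by auto
  qed
  have cY: "continuous_on A Y" for A unfolding Y_def by (intro continuous_intros)
  have dY: "(Y has_real_derivative - Y s) (at s)" if "s > -1" for s
  proof -
    have "\<forall>\<^sub>F s in nhds s. s \<in> {-1<..}" using that by (intro eventually_nhds_in_open) auto
    then have ev: "\<forall>\<^sub>F s in nhds s. Y s = a * exp (- s)" by eventually_elim (simp add: Y_def)
    have "((\<lambda>s. a * exp (- s)) has_real_derivative - Y s) (at s)"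
      using that by (auto intro!: derivative_eq_intros simp: Y_def)
    then show ?thesis using DERIV_cong_ev[OF refl ev refl] by simp
  qed
  define w where "w s = U (Y s)" for s
  define q where "q s = U' (Y s)" for s
  have cq: "continuous_on A q" for A
    unfolding q_def by (rule continuous_on_compose2[OF cont_U' cY]) (use Yran in auto)
  have cw: "continuous_on A w" for A
    unfolding w_def by (rule continuous_on_compose2[OF cont_U cY]) (use Yran in auto)
  have dw: "(w has_real_derivative q s * - Y s) (at s)" if "s > -1" for s
    unfolding w_def q_def by (rule DERIV_chain2[OF DERIV_U[OF Yran] dY[OF that]])
  have dz: "((\<lambda>s. - Y s) has_real_derivative
      - (q s * binet_force \<phi> l (w s))) (at s)" if "s > -1" for s
  proof -
    have "- (q s * binet_force \<phi> l (w s)) = - (- Y s)"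
      using energy[OF Yran[of s]] by (simp add: w_def q_def algebra_simps)
    then show ?thesis using DERIV_minus[OF dY[OF that]] by simp
  qed
  have wpos: "w s > 0" for s using Upos[OF Yran] by (simp add: w_def)
  have cb: "c \<le> q s / (w s)\<^sup>2" for s using c(2)[OF Yran] by (simp add: w_def q_def)
  obtain \<tau> \<Theta> x y where \<tau>: "\<tau> 0 = 0" "strict_mono \<tau>"
    and x: "\<And>t. x t = cos (\<Theta> (\<tau> t)) / w (\<tau> t)" and y: "\<And>t. y t = sin (\<Theta> (\<tau> t)) / w (\<tau> t)"
    and sol: "solution_on \<phi> {t. \<tau> t \<in> {-1<..}} x y"
    and p0: "phase_point x y 0 = (Complex (1 / w 0) 0, Complex (- l * - Y 0) (l * w 0))"
    by (rule solution_of_binet_curve[where l=l and D="{-1<..}" and q=q and w=w and z="\<lambda>s. - Y s" and c=c and \<phi>=\<phi>])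
       (use l cq cw c(1) cb wpos dw dz in auto)
  have I: "t \<in> {t. \<tau> t \<in> {-1<..}}" if "t \<ge> 0" for t
    using strict_mono_less_eq[OF \<tau>(2), of 0 t] that \<tau>(1) by simp
  have "phase_point x y 0 \<in> W" using p0 a a1(2)[of a] by (simp add: w_def Y_def)
  then obtain T where T: "T > 0" "\<And>t. t \<ge> 0 \<Longrightarrow> x (t + T) = x t \<and> y (t + T) = y t"
    using WP[OF sol] I by (metis order.refl add_nonneg_nonneg less_imp_le)
  have rad: "(x t)\<^sup>2 + (y t)\<^sup>2 = (1 / w (\<tau> t))\<^sup>2" for t
    by (simp add: x y power_divide flip: add_divide_distrib)
  have "(1 / w (\<tau> T))\<^sup>2 = (1 / w 0)\<^sup>2"
    using rad[of 0] rad[of T] T(2)[of 0] \<tau>(1) by simp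
  then have weq: "w (\<tau> T) = w 0"
    using wpos[of "\<tau> T"] wpos[of 0] by (simp add: power_divide power2_eq_iff_nonneg)
  have "\<tau> T > 0" using strict_monoD[OF \<tau>(2) T(1)] \<tau>(1) by simp
  then have "Y (\<tau> T) < Y 0" using a(1) by (simp add: Y_def)
  then have "w (\<tau> T) < w 0" unfolding w_def using U_less Yran by auto
  then show False using weq by simp
qed

text \<open>
  For \<open>l\<^sup>2 = K\<close> the centrifugal force balances the attraction at every radius, so the radius may grow
  linearly in time.
\<close>

lemma no_inverse_cube_force:
  fixes K :: real
  assumes per: "all_solutions_near_circular_motions_periodic \<phi>"
    and K: "K > 0" and \<phi>: "\<And>\<eta>. \<eta> > 0 \<Longrightarrow> \<phi> \<eta> = K / \<eta>\<^sup>2"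
  shows False
proof -
  define l where "l = sqrt K"
  have l: "l > 0" "l\<^sup>2 = K" using K by (auto simp: l_def)
  obtain W where W: "open W" "(Complex (1 / 1) 0, Complex 0 (l * 1)) \<in> W"
    and WP: "\<And>I x y. solution_on \<phi> I x y \<Longrightarrow> 0 \<in> I \<Longrightarrow> phase_point x y 0 \<in> W \<Longrightarrow>
       \<exists>T>0. \<forall>t\<in>I. t + T \<in> I \<longrightarrow> x (t + T) = x t \<and> y (t + T) = y t"
    using periodic_near_circular_orbit[OF per _ l(1), of 1] \<phi>[of 1] l by auto
  have "((\<lambda>e. (Complex 1 0, Complex e l)) \<longlongrightarrow> (Complex 1 0, Complex 0 l)) (at_right 0)"
    by (intro tendsto_intros)
  then have "\<forall>\<^sub>F e in at_right 0. (Complex 1 0, Complex e l) \<in> W"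
    using W by (auto dest: topological_tendstoD)
  then obtain e where e: "e > 0" "(Complex 1 0, Complex e l) \<in> W"
    unfolding eventually_at_right_field by (meson dense)
  define r where "r t = 1 + e * t" for t
  define \<theta> where "\<theta> t = l / e * (1 - 1 / r t)" for t
  define I where "I = {- 1 / e<..}"
  have rp: "r t > 0" if "t \<in> I" for t using that e by (simp add: I_def r_def field_simps)
  have dr: "(r has_real_derivative e) (at t)" for t
    unfolding r_def by (auto intro!: derivative_eq_intros)
  have ddr: "((\<lambda>_. e) has_real_derivative l\<^sup>2 / (r t)^3 - \<phi> ((r t)\<^sup>2) * r t) (at t)" if "t \<in> I" for t
  proof -
    have "l\<^sup>2 / (r t)^3 - \<phi> ((r t)\<^sup>2) * r t = 0"
      using rp[OF that] \<phi>[of "(r t)\<^sup>2"] l(2) by (simp add: field_simps power2_eq_square power3_eq_cube)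
    then show ?thesis by simp
  qed
  have d\<theta>: "(\<theta> has_real_derivative l / (r t)\<^sup>2) (at t)" if "t \<in> I" for t
    unfolding \<theta>_def using rp[OF that] e
    by (auto intro!: derivative_eq_intros dr simp: field_simps power2_eq_square)
  have I: "open I" "is_interval I" "0 \<in> I" "I \<noteq> {}"
    using e(1) unfolding I_def is_interval_1 by (auto simp: divide_less_0_iff intro: exI[of _ 0])
  note pol = polar_solution[where r=r and r'="\<lambda>_. e" and \<theta>=\<theta> and l=l and \<phi>=\<phi> and I=I,
      OF I(1,2,4) rp dr ddr d\<theta>]
  have "phase_point (\<lambda>t. r t * cos (\<theta> t)) (\<lambda>t. r t * sin (\<theta> t)) 0 = (Complex 1 0, Complex e l)"
    using pol(2,3)[of 0] I(3) by (auto simp: phase_point_def r_def \<theta>_def)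
  with WP[OF pol(1) I(3)] e(2) obtain T where T: "T > 0" "0 + T \<in> I \<Longrightarrow>
      r (0 + T) * cos (\<theta> (0 + T)) = r 0 * cos (\<theta> 0) \<and> r (0 + T) * sin (\<theta> (0 + T)) = r 0 * sin (\<theta> 0)"
    using I(3) by (metis (no_types, lifting))
  have "T \<in> I" using T(1) e(1) less_trans[of "- (1 / e)" 0 T] by (simp add: I_def)
  then have "(r T * cos (\<theta> T))\<^sup>2 + (r T * sin (\<theta> T))\<^sup>2 = 1"
    using T(2) by (simp add: r_def \<theta>_def)
  then have "(r T)\<^sup>2 = 1" by (simp add: power_mult_distrib flip: distrib_left)
  moreover have "r T > 1" using T(1) e(1) by (simp add: r_def)
  ultimately show False by (simp add: power2_eq_1_iff)
qed

section \<open>Isochrony to second order\<close>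

lemma has_integral_trig_quadratic:
  fixes c0 c1 c2 :: real
  shows "((\<lambda>s. c0 + c1 * sin s + c2 * (sin s)\<^sup>2) has_integral (2 * pi * c0 + pi * c2)) {0..2*pi}"
proof -
  define G where "G s = c0 * s - c1 * cos s + c2 * ((s - sin s * cos s) / 2)" for s
  have sq: "(1 - (cos s * cos s - sin s * sin s)) / 2 = (sin s)\<^sup>2" for s :: real
    using sin_cos_squared_add[of s] by (simp add: power2_eq_square)
  have "(G has_real_derivative c0 + c1 * sin s + c2 * ((1 - (cos s * cos s - sin s * sin s)) / 2)) (at s)" for s
    unfolding G_def by (auto intro!: derivative_eq_intros)
  then have "((\<lambda>s. c0 + c1 * sin s + c2 * (sin s)\<^sup>2) has_integral (G (2 * pi) - G 0)) {0..2*pi}"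
    unfolding sq
    by (intro fundamental_theorem_of_calculus)
       (auto simp: has_real_derivative_iff_has_vector_derivative[symmetric]
         intro: has_field_derivative_at_within)
  then show ?thesis by (simp add: G_def algebra_simps)
qed

context energy_chart
begin

text \<open>
  Write \<open>w = U y - U 0\<close>. From \<open>y\<^sup>2 = 2 * V w\<close> one expands \<open>y / w\<close> to second order in \<open>w\<close>, and from
  \<open>f * U' = y\<close> then \<open>U'\<close>, first in \<open>w\<close> and then in \<open>y\<close>. The linear term in \<open>y = a * sin s\<close> has mean zero
  over a period, so a period independent of the amplitude forces the quadratic coefficient \<open>C\<close> to
  vanish, and \<open>C\<close> is a multiple of \<open>10 * A\<^sup>2 - 9 * k * B\<close>.
\<close>

lemma second_order_isochrony:
  assumes k: "k > 0" and U'0: "U' 0 = 1 / sqrt k"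
    and f3: "((\<lambda>w. (f (U 0 + w) - (k * w + A * w\<^sup>2 + B * w^3)) / w^3) \<longlongrightarrow> 0) (at 0)"
    and iso: "0 < a0" "a0 \<le> b"
      "\<And>a. 0 \<le> a \<Longrightarrow> a < a0 \<Longrightarrow> integral {0..2*pi} (\<lambda>s. U' (a * sin s)) = 2 * pi * U' 0"
  shows "10 * A\<^sup>2 = 9 * k * B"
proof -
  define s0 s1 s2 where "s0 = sqrt k" and "s1 = A / (3 * s0)" and "s2 = (B / 2 - s1\<^sup>2) / (2 * s0)"
  have s0: "s0 > 0" "s0 * s0 = k" using k by (auto simp: s0_def)
  define w where "w y = U y - U 0" for y
  define ev where "ev y \<longleftrightarrow> y \<noteq> 0 \<and> \<bar>y\<bar> < b" for y
  have ev: "\<forall>\<^sub>F y in at 0. ev y"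
    unfolding ev_def eventually_at using b by (auto simp: dist_real_def)
  have w0: "w 0 = 0" by (simp add: w_def)
  have wn: "w y \<noteq> 0" "w y / y > 0" if "ev y" for y
  proof -
    have "w y > 0 \<and> y > 0 \<or> w y < 0 \<and> y < 0"
      using U_less[of 0 y] U_less[of y 0] that b by (cases y "0 :: real" rule: linorder_cases) (auto simp: ev_def w_def)
    then show "w y \<noteq> 0" "w y / y > 0" by (auto simp: zero_less_divide_iff)
  qed
  have mem: "y \<in> {-b..b}" if "ev y \<or> y = 0" for y
    using that b by (auto simp: ev_def)
  have contU: "isCont U y" if "ev y \<or> y = 0" for y
    using DERIV_isCont[OF DERIV_U[OF mem[OF that]]] .
  have limw: "(w \<longlongrightarrow> 0) (at 0)"
    using contU[of 0] unfolding isCont_def w_def by (auto intro!: tendsto_eq_intros)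
  have fw: "filterlim w (at 0) (at 0)"
    unfolding filterlim_at using limw ev wn(1) by (auto elim: eventually_mono)
  define g where "g y = f (U y) / w y" for y
  define v where "v y = y / w y" for y
  have g2: "((\<lambda>y. (g y - (k + A * w y + B * (w y)\<^sup>2)) / (w y)\<^sup>2) \<longlongrightarrow> 0) (at 0)"
  proof (rule Lim_transform_eventually[OF filterlim_compose[OF f3 fw]])
    show "\<forall>\<^sub>F y in at 0. (f (U 0 + w y) - (k * w y + A * (w y)\<^sup>2 + B * (w y)^3)) / (w y)^3 =
        (g y - (k + A * w y + B * (w y)\<^sup>2)) / (w y)\<^sup>2"
      using ev by eventually_elim
        (use wn(1) in \<open>simp add: g_def w_def field_simps power2_eq_square power3_eq_cube\<close>)
  qed
  have v2: "((\<lambda>y. ((v y)\<^sup>2 - (k + 2 / 3 * A * w y + B / 2 * (w y)\<^sup>2)) / (w y)\<^sup>2) \<longlongrightarrow> 0) (at 0)"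
  proof -
    have dw: "(w has_real_derivative U' y) (at y)" if "ev y \<or> y = 0" for y
      unfolding w_def using DERIV_diff[OF DERIV_U[OF mem[OF that]] DERIV_const[of "U 0"]] by simp
    define N where "N y = y\<^sup>2 - (k * (w y)\<^sup>2 + 2 / 3 * A * (w y)^3 + B / 2 * (w y)^4)" for y
    have dN: "(N has_real_derivative
        2 * U' y * (f (U y) - (k * w y + A * (w y)\<^sup>2 + B * (w y)^3))) (at y)" if "ev y \<or> y = 0" for y
      unfolding N_def using energy[OF mem[OF that]]
      by (auto intro!: derivative_eq_intros dw[OF that] simp: algebra_simps)
    have dD: "((\<lambda>y. (w y)^4) has_real_derivative 4 * (w y)^3 * U' y) (at y)" if "ev y \<or> y = 0" for y
      by (auto intro!: derivative_eq_intros dw[OF that])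
    \<comment> \<open>The expansion of the potential comes from that of the force by de l'Hospital's rule; a factor
       \<open>U'\<close> appears in both derivatives and cancels.\<close>
    have "((\<lambda>y. N y / (w y)^4) \<longlongrightarrow> 0) (at 0)"
    proof (rule lhopital)
      have "isCont N 0" using dN DERIV_isCont by blast
      then show "(N \<longlongrightarrow> 0) (at 0)" by (simp add: isCont_def N_def w0)
      show "((\<lambda>y. (w y)^4) \<longlongrightarrow> 0) (at 0)" using tendsto_power[OF limw, of 4] by simp
      show "\<forall>\<^sub>F y in at 0. (w y)^4 \<noteq> 0" using ev by eventually_elim (simp add: wn)
      show "\<forall>\<^sub>F y in at 0. 4 * (w y)^3 * U' y \<noteq> 0"
        using ev
      proof eventually_elim
        case (elim y)
        then show ?case using wn(1)[OF elim] U'_pos[OF mem, of y] by simp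
      qed
      show "\<forall>\<^sub>F y in at 0. (N has_real_derivative
          2 * U' y * (f (U y) - (k * w y + A * (w y)\<^sup>2 + B * (w y)^3))) (at y)"
        using ev by eventually_elim (simp add: dN)
      show "\<forall>\<^sub>F y in at 0. ((\<lambda>y. (w y)^4) has_real_derivative 4 * (w y)^3 * U' y) (at y)"
        using ev by eventually_elim (simp add: dD)
      have "((\<lambda>y. (f (U 0 + w y) - (k * w y + A * (w y)\<^sup>2 + B * (w y)^3)) / (w y)^3 / 2) \<longlongrightarrow> 0 / 2) (at 0)"
        by (intro tendsto_intros filterlim_compose[OF f3 fw]) simp
      then have *: "((\<lambda>y. (f (U 0 + w y) - (k * w y + A * (w y)\<^sup>2 + B * (w y)^3)) / (w y)^3 / 2) \<longlongrightarrow> 0) (at 0)"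
        by simp
      show "((\<lambda>y. 2 * U' y * (f (U y) - (k * w y + A * (w y)\<^sup>2 + B * (w y)^3)) / (4 * (w y)^3 * U' y))
          \<longlongrightarrow> 0) (at 0)"
      proof (rule Lim_transform_eventually[OF *])
        show "\<forall>\<^sub>F y in at 0. (f (U 0 + w y) - (k * w y + A * (w y)\<^sup>2 + B * (w y)^3)) / (w y)^3 / 2 =
          2 * U' y * (f (U y) - (k * w y + A * (w y)\<^sup>2 + B * (w y)^3)) / (4 * (w y)^3 * U' y)"
          using ev
        proof eventually_elim
          case (elim y)
          have "U' y \<noteq> 0" using U'_pos[OF mem, of y] elim by simp
          moreover have "U 0 + w y = U y" by (simp add: w_def)
          ultimately show ?case using wn(1)[OF elim] by (simp add: divide_simps)
        qed
      qed
    qed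
    then show ?thesis
    proof (rule Lim_transform_eventually)
      show "\<forall>\<^sub>F y in at 0. N y / (w y)^4 = ((v y)\<^sup>2 - (k + 2 / 3 * A * w y + B / 2 * (w y)\<^sup>2)) / (w y)\<^sup>2"
        using ev by eventually_elim
          (use wn(1) in \<open>simp add: N_def v_def power_divide divide_simps power2_eq_square
            power3_eq_cube power4_eq_xxxx algebra_simps\<close>)
    qed
  qed
  have lin: "((\<lambda>y. h y) \<longlongrightarrow> c0) (at 0) \<and> ((\<lambda>y. (h y - c0) / w y) \<longlongrightarrow> c1) (at 0)"
    if "((\<lambda>y. (h y - (c0 + c1 * w y + c2 * (w y)\<^sup>2)) / (w y)\<^sup>2) \<longlongrightarrow> 0) (at 0)" for h c0 c1 c2
  proof
    have "((\<lambda>y. (h y - (c0 + c1 * w y + c2 * (w y)\<^sup>2)) / (w y)\<^sup>2 * (w y)\<^sup>2 + (c0 + c1 * w y + c2 * (w y)\<^sup>2))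
        \<longlongrightarrow> 0 * 0\<^sup>2 + (c0 + c1 * 0 + c2 * 0\<^sup>2)) (at 0)"
      by (intro tendsto_intros that limw)
    then have "((\<lambda>y. (h y - (c0 + c1 * w y + c2 * (w y)\<^sup>2)) / (w y)\<^sup>2 * (w y)\<^sup>2 + (c0 + c1 * w y + c2 * (w y)\<^sup>2))
        \<longlongrightarrow> c0) (at 0)" by simp
    then show "(h \<longlongrightarrow> c0) (at 0)"
      by (rule Lim_transform_eventually) (use ev in eventually_elim, use wn(1) in simp)
    have "((\<lambda>y. (h y - (c0 + c1 * w y + c2 * (w y)\<^sup>2)) / (w y)\<^sup>2 * w y + (c1 + c2 * w y))
        \<longlongrightarrow> 0 * 0 + (c1 + c2 * 0)) (at 0)"
      by (intro tendsto_intros that limw)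
    then have "((\<lambda>y. (h y - (c0 + c1 * w y + c2 * (w y)\<^sup>2)) / (w y)\<^sup>2 * w y + (c1 + c2 * w y))
        \<longlongrightarrow> c1) (at 0)" by simp
    then show "((\<lambda>y. (h y - c0) / w y) \<longlongrightarrow> c1) (at 0)"
    proof (rule Lim_transform_eventually)
      show "\<forall>\<^sub>F y in at 0. (h y - (c0 + c1 * w y + c2 * (w y)\<^sup>2)) / (w y)\<^sup>2 * w y + (c1 + c2 * w y) = (h y - c0) / w y"
        using ev by eventually_elim (use wn(1) in \<open>simp add: divide_simps power2_eq_square algebra_simps\<close>)
    qed
  qed
  have limg: "(g \<longlongrightarrow> k) (at 0)" using lin[OF g2] by blast
  have vpos: "v y > 0" if "ev y" for y
    using wn(2)[OF that] by (auto simp: v_def zero_less_divide_iff)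
  have limv: "(v \<longlongrightarrow> s0) (at 0)"
  proof -
    have "((\<lambda>y. sqrt ((v y)\<^sup>2)) \<longlongrightarrow> sqrt k) (at 0)"
      using lin[OF v2] by (intro tendsto_intros) auto
    then show ?thesis unfolding s0_def
      by (rule Lim_transform_eventually) (use ev in eventually_elim, use vpos in \<open>simp add: less_imp_le\<close>)
  qed
  have As: "2 / 3 * A = 2 * s0 * s1" "B / 2 = s1\<^sup>2 + 2 * s0 * s2"
    using s0 by (auto simp: s1_def s2_def field_simps)
  \<comment> \<open>Square root of an expansion: divide the difference of squares by the sum of the roots.\<close>
  have v1: "((\<lambda>y. (v y - (s0 + s1 * w y + s2 * (w y)\<^sup>2)) / (w y)\<^sup>2) \<longlongrightarrow> 0) (at 0)"
  proof -
    have "((\<lambda>y. (((v y)\<^sup>2 - (k + 2 / 3 * A * w y + B / 2 * (w y)\<^sup>2)) / (w y)\<^sup>2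
          + (- 2 * s1 * s2 * w y - s2\<^sup>2 * (w y)\<^sup>2)) / (v y + (s0 + s1 * w y + s2 * (w y)\<^sup>2)))
        \<longlongrightarrow> (0 + (- 2 * s1 * s2 * 0 - s2\<^sup>2 * 0\<^sup>2)) / (s0 + (s0 + s1 * 0 + s2 * 0\<^sup>2))) (at 0)"
      by (intro tendsto_intros v2 limv limw) (use s0 in auto)
    then have l: "((\<lambda>y. (((v y)\<^sup>2 - (k + 2 / 3 * A * w y + B / 2 * (w y)\<^sup>2)) / (w y)\<^sup>2
          + (- 2 * s1 * s2 * w y - s2\<^sup>2 * (w y)\<^sup>2)) / (v y + (s0 + s1 * w y + s2 * (w y)\<^sup>2))) \<longlongrightarrow> 0) (at 0)"
      by simp
    have "((\<lambda>y. v y + (s0 + s1 * w y + s2 * (w y)\<^sup>2)) \<longlongrightarrow> s0 + (s0 + s1 * 0 + s2 * 0\<^sup>2)) (at 0)"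
      by (intro tendsto_intros limv limw)
    then have vp: "\<forall>\<^sub>F y in at 0. v y + (s0 + s1 * w y + s2 * (w y)\<^sup>2) > 0"
      by (rule order_tendstoD(1)) (use s0 in simp)
    show ?thesis
    proof (rule Lim_transform_eventually[OF l], use vp ev in eventually_elim)
      case (elim y)
      define W where "W = w y"
      define p where "p = s0 + s1 * W + s2 * W\<^sup>2"
      have "(v y)\<^sup>2 - (k + 2 / 3 * A * W + B / 2 * W\<^sup>2) + (- 2 * s1 * s2 * W - s2\<^sup>2 * W\<^sup>2) * W\<^sup>2
          = (v y)\<^sup>2 - p\<^sup>2"
        unfolding As p_def s0(2)[symmetric] by (simp add: power2_eq_square algebra_simps)
      also have "\<dots> = (v y - p) * (v y + p)" by (simp add: power2_eq_square algebra_simps)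
      finally have *: "((v y)\<^sup>2 - (k + 2 / 3 * A * W + B / 2 * W\<^sup>2) + (- 2 * s1 * s2 * W - s2\<^sup>2 * W\<^sup>2) * W\<^sup>2)
         = (v y - p) * (v y + p)" .
      have W: "W \<noteq> 0" using wn(1)[OF elim(2)] by (simp add: W_def)
      have "((v y)\<^sup>2 - (k + 2 / 3 * A * W + B / 2 * W\<^sup>2)) / W\<^sup>2 + (- 2 * s1 * s2 * W - s2\<^sup>2 * W\<^sup>2)
          = (v y - p) * (v y + p) / W\<^sup>2"
        unfolding *[symmetric] using W by (simp add: add_divide_distrib)
      moreover have "v y + p \<noteq> 0" using elim(1) by (simp add: p_def W_def)
      ultimately show ?case unfolding W_def[symmetric] p_def[symmetric] by simp
    qed
  qed
  have v1l: "((\<lambda>y. (v y - s0) / w y) \<longlongrightarrow> s1) (at 0)" using lin[OF v1] by blast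
  define D0 where "D0 = 1 / s0"
  define D1 where "D1 = (s1 - D0 * A) / k"
  define D2 where "D2 = (s2 - D0 * B - D1 * A) / k"
  have rel: "s0 = D0 * k" "s1 = D1 * k + D0 * A" "s2 = D2 * k + D0 * B + D1 * A"
  proof -
    show "s0 = D0 * k" using s0(1) by (simp add: D0_def s0(2)[symmetric])
    show "s1 = D1 * k + D0 * A" using k by (simp add: D1_def)
    show "s2 = D2 * k + D0 * B + D1 * A" using k by (simp add: D2_def)
  qed
  have U'eq: "U' y = v y / g y" if "ev y" for y
  proof -
    have e: "f (U y) * U' y = y" using energy[OF mem, of y] that by simp
    moreover have "y \<noteq> 0" using that by (simp add: ev_def)
    ultimately have "f (U y) \<noteq> 0" by auto
    then show ?thesis using e wn(1)[OF that] by (simp add: v_def g_def field_simps)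
  qed
  \<comment> \<open>\<open>U' = v / g\<close>, and the \<open>D\<close>s are the coefficients of the quotient of the two expansions.\<close>
  have D: "((\<lambda>y. (U' y - (D0 + D1 * w y + D2 * (w y)\<^sup>2)) / (w y)\<^sup>2) \<longlongrightarrow> 0) (at 0)"
  proof -
    have "((\<lambda>y. ((v y - (s0 + s1 * w y + s2 * (w y)\<^sup>2)) / (w y)\<^sup>2
         - (D0 + D1 * w y + D2 * (w y)\<^sup>2) * ((g y - (k + A * w y + B * (w y)\<^sup>2)) / (w y)\<^sup>2)
         - ((D1 * B + D2 * A) * w y + D2 * B * (w y)\<^sup>2)) / g y)
       \<longlongrightarrow> (0 - (D0 + D1 * 0 + D2 * 0\<^sup>2) * 0 - ((D1 * B + D2 * A) * 0 + D2 * B * 0\<^sup>2)) / k) (at 0)"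
      by (intro tendsto_intros v1 g2 limw limg) (use k in auto)
    then have l: "((\<lambda>y. ((v y - (s0 + s1 * w y + s2 * (w y)\<^sup>2)) / (w y)\<^sup>2
         - (D0 + D1 * w y + D2 * (w y)\<^sup>2) * ((g y - (k + A * w y + B * (w y)\<^sup>2)) / (w y)\<^sup>2)
         - ((D1 * B + D2 * A) * w y + D2 * B * (w y)\<^sup>2)) / g y) \<longlongrightarrow> 0) (at 0)" by simp
    have gp: "\<forall>\<^sub>F y in at 0. g y > 0" using limg k by (rule order_tendstoD(1))
    show ?thesis
    proof (rule Lim_transform_eventually[OF l], use gp ev in eventually_elim)
      case (elim y)
      define W where "W = w y"
      have W: "W \<noteq> 0" using wn(1)[OF elim(2)] by (simp add: W_def)
      have common: "X / q - P * (Z / q) - R = (X - P * Z - R * q) / q" if "q \<noteq> 0" for X P Z R q :: real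
        using that by (simp add: field_simps)
      have "(v y - (s0 + s1 * W + s2 * W\<^sup>2)) / W\<^sup>2
         - (D0 + D1 * W + D2 * W\<^sup>2) * ((g y - (k + A * W + B * W\<^sup>2)) / W\<^sup>2)
         - ((D1 * B + D2 * A) * W + D2 * B * W\<^sup>2)
         = (v y - (s0 + s1 * W + s2 * W\<^sup>2)
         - (D0 + D1 * W + D2 * W\<^sup>2) * (g y - (k + A * W + B * W\<^sup>2))
         - ((D1 * B + D2 * A) * W + D2 * B * W\<^sup>2) * W\<^sup>2) / W\<^sup>2"
        by (rule common) (use W in simp)
      also have "\<dots> = (v y - (D0 + D1 * W + D2 * W\<^sup>2) * g y) / W\<^sup>2"
        unfolding rel by (simp add: algebra_simps power2_eq_square)
      finally have *: "(v y - (s0 + s1 * W + s2 * W\<^sup>2)) / W\<^sup>2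
         - (D0 + D1 * W + D2 * W\<^sup>2) * ((g y - (k + A * W + B * W\<^sup>2)) / W\<^sup>2)
         - ((D1 * B + D2 * A) * W + D2 * B * W\<^sup>2) = (v y - (D0 + D1 * W + D2 * W\<^sup>2) * g y) / W\<^sup>2" .
      have "(X - P * G) / q / G = (X / G - P) / q" if "G \<noteq> 0" for X P G q :: real
        using that by (simp add: diff_divide_distrib)
      then show ?case unfolding W_def[symmetric] * U'eq[OF elim(2)]
        using elim(1) by simp
    qed
  qed
  define C where "C = D2 / k - D1 * s1 / s0^3"
  define e1 where "e1 = D1 / s0"
  \<comment> \<open>Passage from \<open>w\<close> to \<open>y = v * w\<close>; the curvature of this change contributes the term with \<open>s1\<close>.\<close>
  have quad: "((\<lambda>y. (U' y - (D0 + e1 * y)) / y\<^sup>2) \<longlongrightarrow> C) (at 0)"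
  proof -
    have "((\<lambda>y. ((U' y - (D0 + D1 * w y + D2 * (w y)\<^sup>2)) / (w y)\<^sup>2 + D2 - D1 / s0 * ((v y - s0) / w y)) / (v y)\<^sup>2)
        \<longlongrightarrow> (0 + D2 - D1 / s0 * s1) / s0\<^sup>2) (at 0)"
      by (intro tendsto_intros D v1l limv) (use s0 in auto)
    moreover have "(0 + D2 - D1 / s0 * s1) / s0\<^sup>2 = C"
      using s0 by (simp add: C_def s0(2)[symmetric] field_simps power2_eq_square power3_eq_cube)
    ultimately have l: "((\<lambda>y. ((U' y - (D0 + D1 * w y + D2 * (w y)\<^sup>2)) / (w y)\<^sup>2 + D2 - D1 / s0 * ((v y - s0) / w y)) / (v y)\<^sup>2)
        \<longlongrightarrow> C) (at 0)" by simp
    show ?thesis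
    proof (rule Lim_transform_eventually[OF l], use ev in eventually_elim)
      case (elim y)
      have y: "y = v y * w y" "w y \<noteq> 0" "v y \<noteq> 0"
        using wn(1)[OF elim] vpos[OF elim] by (auto simp: v_def)
      have "(U' y - (D0 + e1 * (v y * w y))) / (v y * w y)\<^sup>2 =
         ((U' y - (D0 + D1 * w y + D2 * (w y)\<^sup>2)) / (w y)\<^sup>2 + D2 - D1 / s0 * ((v y - s0) / w y)) / (v y)\<^sup>2"
        using y(2,3) s0(1) unfolding e1_def by (simp add: field_simps power2_eq_square)
      then show ?case using y(1) by simp
    qed
  qed
  have "C = 0"
  proof (rule ccontr)
    assume "C \<noteq> 0"
    then have "\<forall>\<^sub>F y in at 0. dist ((U' y - (D0 + e1 * y)) / y\<^sup>2) C < \<bar>C\<bar> / 2"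
      using quad by (intro tendstoD) auto
    then obtain d where d: "d > 0"
      "\<And>y. y \<noteq> 0 \<Longrightarrow> \<bar>y\<bar> < d \<Longrightarrow> \<bar>(U' y - (D0 + e1 * y)) / y\<^sup>2 - C\<bar> < \<bar>C\<bar> / 2"
      unfolding eventually_at dist_real_def by auto
    have D0: "U' 0 = D0" by (simp add: U'0 D0_def s0_def)
    have bound: "\<bar>U' y - (D0 + e1 * y) - C * y\<^sup>2\<bar> \<le> \<bar>C\<bar> / 2 * y\<^sup>2" if "\<bar>y\<bar> < d" for y
    proof (cases "y = 0")
      case False
      then have "U' y - (D0 + e1 * y) - C * y\<^sup>2 = ((U' y - (D0 + e1 * y)) / y\<^sup>2 - C) * y\<^sup>2"
        by (simp add: field_simps)
      then have "\<bar>U' y - (D0 + e1 * y) - C * y\<^sup>2\<bar> = \<bar>(U' y - (D0 + e1 * y)) / y\<^sup>2 - C\<bar> * y\<^sup>2"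
        by (simp add: abs_mult)
      also have "\<dots> \<le> \<bar>C\<bar> / 2 * y\<^sup>2"
        using d(2)[OF False that] by (intro mult_right_mono) auto
      finally show ?thesis .
    qed (simp add: D0)
    define a where "a = min a0 d / 2"
    have a: "0 < a" "a < a0" "a < d" using iso(1) d(1) by (auto simp: a_def)
    have ran: "\<bar>a * sin s\<bar> \<le> a" for s using a(1) by (simp add: abs_mult mult_left_le)
    have i1: "((\<lambda>s. U' (a * sin s)) has_integral 2 * pi * D0) {0..2*pi}"
    proof -
      have "continuous_on {0..2*pi} (\<lambda>s. U' (a * sin s))"
      proof (rule continuous_on_compose2[OF cont_U'])
        show "(\<lambda>s. a * sin s) ` {0..2*pi} \<subseteq> {-b..b}"
        proof
          fix y assume "y \<in> (\<lambda>s. a * sin s) ` {0..2*pi}"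
          then obtain s where "y = a * sin s" by blast
          then show "y \<in> {-b..b}" using ran[of s] a(2) iso(2) by auto
        qed
      qed (intro continuous_intros)
      then show ?thesis
        using iso(3)[of a] a D0 integrable_continuous_real integrable_integral by (metis less_imp_le)
    qed
    have i2: "((\<lambda>s. D0 + e1 * (a * sin s) + C * (a * sin s)\<^sup>2) has_integral
        (2 * pi * D0 + C * a\<^sup>2 * pi)) {0..2*pi}"
    proof -
      have "(\<lambda>s. D0 + e1 * (a * sin s) + C * (a * sin s)\<^sup>2) =
          (\<lambda>s. D0 + (e1 * a) * sin s + (C * a\<^sup>2) * (sin s)\<^sup>2)"
        by (simp add: power_mult_distrib mult.assoc)
      then show ?thesis
        using has_integral_trig_quadratic[of D0 "e1 * a" "C * a\<^sup>2"] by (simp add: mult_ac)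
    qed
    have i3: "((\<lambda>s. \<bar>C\<bar> / 2 * (a * sin s)\<^sup>2) has_integral (\<bar>C\<bar> / 2 * a\<^sup>2 * pi)) {0..2*pi}"
    proof -
      have "(\<lambda>s. \<bar>C\<bar> / 2 * (a * sin s)\<^sup>2) = (\<lambda>s. 0 + 0 * sin s + (\<bar>C\<bar> / 2 * a\<^sup>2) * (sin s)\<^sup>2)"
        by (simp add: power_mult_distrib mult.assoc)
      then show ?thesis
        using has_integral_trig_quadratic[of 0 0 "\<bar>C\<bar> / 2 * a\<^sup>2"] by (simp add: mult_ac)
    qed
    note diff = has_integral_diff[OF i1 i2]
    have "\<bar>U' (a * sin s) - (D0 + e1 * (a * sin s) + C * (a * sin s)\<^sup>2)\<bar> \<le> \<bar>C\<bar> / 2 * (a * sin s)\<^sup>2" for s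
      using bound[of "a * sin s"] ran[of s] a(3) by (simp add: algebra_simps)
    then have "norm (integral {0..2*pi} (\<lambda>s. U' (a * sin s) - (D0 + e1 * (a * sin s) + C * (a * sin s)\<^sup>2)))
        \<le> integral {0..2*pi} (\<lambda>s. \<bar>C\<bar> / 2 * (a * sin s)\<^sup>2)"
      using has_integral_integrable[OF diff] has_integral_integrable[OF i3]
      by (intro integral_norm_bound_integral) auto
    then have "\<bar>C\<bar> * a\<^sup>2 * pi \<le> \<bar>C\<bar> / 2 * a\<^sup>2 * pi"
      unfolding integral_unique[OF diff] integral_unique[OF i3] by (simp add: abs_mult)
    then show False using \<open>C \<noteq> 0\<close> a(1) by simp
  qed
  moreover have "C = (5 * A\<^sup>2 / (6 * k) - 3 * B / 4) / (k * k * s0)"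
    using s0 unfolding C_def D2_def D1_def D0_def s2_def s1_def s0(2)[symmetric]
    by (simp add: divide_simps power2_eq_square power3_eq_cube)
  ultimately show ?thesis using k s0 by (simp add: field_simps)
qed

end

lemma powr_third_order:
  fixes m :: real
  shows "((\<lambda>w. ((1 + w) powr m - (1 + m * w + m * (m - 1) / 2 * w\<^sup>2 + m * (m - 1) * (m - 2) / 6 * w^3)) / w^3)
    \<longlongrightarrow> 0) (at 0)"
  unfolding filterlim_at_split by (intro conjI; real_asymp)

section \<open>Power laws\<close>

text \<open>
  The numbers attached to the circular motion of squared radius \<open>\<rho>\<close>: reciprocal radius, angular
  momentum, and the squared frequency, per unit of angle, of small radial oscillations about it.
\<close>

lemma binet_force_deriv:
  fixes \<rho> d l :: real
  defines "u0 \<equiv> 1 / sqrt \<rho>"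
  assumes \<rho>: "\<rho> > 0" "\<phi> \<rho> > 0" and d: "(\<phi> has_real_derivative d) (at \<rho>)" and l: "l = \<rho> * sqrt (\<phi> \<rho>)"
  shows "u0 > 0" and "l > 0" and "1 / u0\<^sup>2 = \<rho>" and "\<phi> (1 / u0\<^sup>2) = l\<^sup>2 * u0^4"
    and "binet_force \<phi> l u0 = 0"
    and "((binet_force \<phi> l) has_real_derivative 4 + 2 * \<rho> * d / \<phi> \<rho>) (at u0)"
proof -
  show u0: "u0 > 0" and l0: "l > 0" using \<rho> l by (auto simp: u0_def)
  have u2: "\<rho> = 1 / u0\<^sup>2" using \<rho> by (simp add: u0_def power_divide)
  then show "1 / u0\<^sup>2 = \<rho>" by simp
  have l2: "\<phi> \<rho> = l\<^sup>2 * u0^4"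
  proof -
    have "l\<^sup>2 = \<rho>\<^sup>2 * \<phi> \<rho>" using l \<rho> by (simp add: power_mult_distrib)
    moreover have "\<rho>\<^sup>2 * u0^4 = 1" using u0 unfolding u2 by (simp add: power_divide)
    ultimately show ?thesis by (simp add: mult_ac)
  qed
  then show circ: "\<phi> (1 / u0\<^sup>2) = l\<^sup>2 * u0^4" using u2 by simp
  then show "binet_force \<phi> l u0 = 0"
    using u0 l0 by (simp add: field_simps eval_nat_numeral)
  have "((\<lambda>u. \<phi> (1 / u\<^sup>2)) has_real_derivative d * (- 2 / u0^3)) (at u0)"
    by (rule DERIV_chain2[of \<phi>]) (use d u2 u0 in \<open>auto intro!: derivative_eq_intros
      simp: field_simps power2_eq_square power3_eq_cube\<close>)
  then have "((binet_force \<phi> l) has_real_derivative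
      1 - (d * (- 2 / u0^3) * (l\<^sup>2 * u0^3) - \<phi> (1 / u0\<^sup>2) * (l\<^sup>2 * (3 * u0\<^sup>2))) /
        ((l\<^sup>2 * u0^3) * (l\<^sup>2 * u0^3))) (at u0)"
    using u0 l0 by (auto intro!: derivative_eq_intros)
  moreover have "1 - (d * (- 2 / u0^3) * (l\<^sup>2 * u0^3) - \<phi> (1 / u0\<^sup>2) * (l\<^sup>2 * (3 * u0\<^sup>2))) /
        ((l\<^sup>2 * u0^3) * (l\<^sup>2 * u0^3)) = 4 + 2 * \<rho> * d / \<phi> \<rho>"
    unfolding l2 circ unfolding u2 using u0 l0 by (simp add: field_simps eval_nat_numeral)
  ultimately show "((binet_force \<phi> l) has_real_derivative 4 + 2 * \<rho> * d / \<phi> \<rho>) (at u0)"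
    by (simp only:)
qed

lemma continuous_on_binet_force:
  assumes "continuous_on {0<..} \<phi>" "l > 0"
  shows "continuous_on {0<..} (binet_force \<phi> l)"
proof -
  have "continuous_on {0<..} (\<lambda>u::real. \<phi> (1 / u\<^sup>2))"
    by (rule continuous_on_compose2[OF assms(1)]) (auto intro!: continuous_intros)
  then show ?thesis using assms(2) by (auto intro!: continuous_intros)
qed

text \<open>
  The frequency \<open>0\<close> is rational as well. Keeping it here spares a separate study of degenerate circular
  motions: by continuity the frequency vanishes on a whole interval of radii or nowhere on it.
\<close>

lemma apsidal_frequency_rational:
  assumes per: "all_solutions_near_circular_motions_periodic \<phi>"
    and cont: "continuous_on {0<..} \<phi>"
    and \<rho>: "\<rho> > 0" "\<phi> \<rho> > 0" and d: "(\<phi> has_real_derivative d) (at \<rho>)"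
  shows "4 + 2 * \<rho> * d / \<phi> \<rho> \<ge> 0" and "sqrt (4 + 2 * \<rho> * d / \<phi> \<rho>) \<in> \<rat>"
proof -
  define k where "k = 4 + 2 * \<rho> * d / \<phi> \<rho>"
  define l where "l = \<rho> * sqrt (\<phi> \<rho>)"
  define u0 where "u0 = 1 / sqrt \<rho>"
  define f where "f = (binet_force \<phi> l)"
  note b = binet_force_deriv[OF \<rho> d l_def, folded u0_def k_def]
  have contf: "continuous_on {0<..} f"
    unfolding f_def by (rule continuous_on_binet_force[OF cont b(2)])
  have f0: "f u0 = 0" and df: "(f has_real_derivative k) (at u0)"
    using b(5,6) by (simp_all add: f_def)
  have "\<not> k < 0"
  proof
    assume "k < 0"
    obtain c U U' where U: "energy_chart (\<lambda>u. - f u) {0<..} c U U'" "U 0 = u0"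
    proof (rule energy_coordinate[of "{0<..}" u0 "\<lambda>u. - f u" "- k"])
      show "continuous_on {0<..} (\<lambda>u. - f u)" using contf by (intro continuous_intros)
      show "((\<lambda>u. - f u) has_real_derivative - k) (at u0)" by (rule DERIV_minus[OF df])
    qed (use b(1) f0 \<open>k < 0\<close> in auto)
    show False
      by (rule no_saddle[OF per b(2) _ U(1)[unfolded f_def]]) (simp only: U(2) b(4))
  qed
  then show "k \<ge> 0" by simp
  show "sqrt k \<in> \<rat>"
  proof (cases "k = 0")
    case False
    with \<open>k \<ge> 0\<close> have "k > 0" by simp
    obtain c U U' where U: "energy_chart f {0<..} c U U'" "U 0 = u0" "U' 0 = 1 / sqrt k"
      by (rule energy_coordinate[of "{0<..}" u0 f k]) (use b(1) contf f0 df \<open>k > 0\<close> in auto)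
    have "\<phi> (1 / (U 0)\<^sup>2) = l\<^sup>2 * (U 0)^4" by (simp only: U(2) b(4))
    from isochronous[OF per b(2) this U(1)[unfolded f_def]] have "U' 0 \<in> \<rat>" by blast
    then have "inverse (U' 0) \<in> \<rat>" by (rule Rats_inverse)
    then show ?thesis by (simp add: U(3))
  qed simp
qed

text \<open>
  The circular motion of radius \<open>1\<close> suffices, all others being similar to it. There Binet's force is
  \<open>u - u powr m\<close> with \<open>m = - 2 * p - 3\<close>, and the second order condition for isochrony becomes
  \<open>m * (m + 3) = 0\<close>: the Kepler problem for \<open>m = 0\<close>, the harmonic oscillator for \<open>m = - 3\<close>.
\<close>

lemma power_force_exponent:
  fixes K p :: real
  assumes per: "all_solutions_near_circular_motions_periodic \<phi>"
    and K: "K > 0" and \<phi>: "\<And>\<eta>. \<eta> > 0 \<Longrightarrow> \<phi> \<eta> = K * \<eta> powr p" and p: "p > -2"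
  shows "p = 0 \<or> p = -3/2"
proof -
  define m where "m = - 2 * p - 3"
  define k where "k = 4 + 2 * p"
  define l where "l = sqrt K"
  define f where "f = (binet_force \<phi> l)"
  have l: "l > 0" "l\<^sup>2 = K" using K by (auto simp: l_def)
  have k: "k > 0" "m = 1 - k" using p by (auto simp: k_def m_def)
  have feq: "f u = u - u powr m" if "u > 0" for u
  proof -
    have "(1 / u\<^sup>2) powr p = u powr (- 2 * p)"
    proof -
      have "1 / u\<^sup>2 = u powr (- 2)" using that by (simp add: powr_minus divide_inverse)
      then show ?thesis by (simp only: powr_powr)
    qed
    moreover have "u powr (- 2 * p) / u^3 = u powr m"
      using that by (simp add: m_def powr_diff powr_numeral)
    ultimately show ?thesis using \<phi>[of "1 / u\<^sup>2"] that K by (simp add: f_def l)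
  qed
  have contf: "continuous_on {0<..} f"
  proof -
    have "continuous_on {0<..} (\<lambda>u::real. u - u powr m)" by (auto intro!: continuous_intros)
    then show ?thesis by (rule continuous_on_eq) (simp add: feq)
  qed
  have df: "(f has_real_derivative k) (at 1)"
  proof -
    have ev: "\<forall>\<^sub>F u in nhds 1. f u = u - u powr m"
      using eventually_nhds_in_open[of "{0<..}" "1::real"] by (auto elim!: eventually_mono simp: feq)
    have "((\<lambda>u. u - u powr m) has_real_derivative k) (at 1)"
      by (auto intro!: derivative_eq_intros simp: k)
    then show ?thesis using DERIV_cong_ev[OF refl ev refl] by simp
  qed
  obtain c U U' where U: "energy_chart f {0<..} c U U'" "U 0 = 1" "U' 0 = 1 / sqrt k"
    by (rule energy_coordinate[of "{0<..}" 1 f k]) (use contf feq[of 1] df k in auto)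
  have "\<phi> (1 / (U 0)\<^sup>2) = l\<^sup>2 * (U 0)^4" using \<phi>[of 1] l by (simp add: U(2))
  from isochronous[OF per l(1) this U(1)[unfolded f_def]] obtain a0 where a0: "0 < a0" "a0 \<le> c"
    "\<And>a. 0 \<le> a \<Longrightarrow> a < a0 \<Longrightarrow> integral {0..2*pi} (\<lambda>s. U' (a * sin s)) = 2 * pi * U' 0"
    by blast
  define A where "A = - (m * (m - 1) / 2)"
  define B where "B = - (m * (m - 1) * (m - 2) / 6)"
  have taylor: "((\<lambda>w. (f (U 0 + w) - (k * w + A * w\<^sup>2 + B * w^3)) / w^3) \<longlongrightarrow> 0) (at 0)"
  proof (rule Lim_transform_eventually)
    show "((\<lambda>w. - (((1 + w) powr m - (1 + m * w + m * (m - 1) / 2 * w\<^sup>2 + m * (m - 1) * (m - 2) / 6 * w^3)) / w^3))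
      \<longlongrightarrow> 0) (at 0)"
      using tendsto_minus[OF powr_third_order[of m]] by simp
    have "\<forall>\<^sub>F w in at 0. w \<in> {-1::real<..}"
      by (intro eventually_at_in_open') auto
    then show "\<forall>\<^sub>F w in at 0. - (((1 + w) powr m - (1 + m * w + m * (m - 1) / 2 * w\<^sup>2 + m * (m - 1) * (m - 2) / 6 * w^3)) / w^3)
       = (f (U 0 + w) - (k * w + A * w\<^sup>2 + B * w^3)) / w^3"
    proof eventually_elim
      case (elim w)
      have "f (U 0 + w) - (k * w + A * w\<^sup>2 + B * w^3) =
        - ((1 + w) powr m - (1 + m * w + m * (m - 1) / 2 * w\<^sup>2 + m * (m - 1) * (m - 2) / 6 * w^3))"
        using elim by (simp add: U(2) feq k(2) A_def B_def algebra_simps)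
      then show ?case by (simp only: minus_divide_left)
    qed
  qed
  have "10 * A\<^sup>2 = 9 * k * B"
    by (rule energy_chart.second_order_isochrony[OF U(1) k(1) U(3) taylor a0])
  then have "(1 - m)\<^sup>2 * (m * (m + 3)) = 0"
    unfolding A_def B_def k_def m_def by (simp add: power2_eq_square field_simps)
  moreover have "1 - m \<noteq> 0" using k by simp
  ultimately have "m = 0 \<or> m = -3" by auto
  then show ?thesis by (auto simp: m_def)
qed

lemma power_law_of_logarithmic_derivative:
  fixes \<phi> \<phi>' :: "real \<Rightarrow> real"
  assumes C: "open C" "connected C" "C \<subseteq> {0<..}" "a \<in> C"
    and d: "\<And>\<rho>. \<rho> \<in> C \<Longrightarrow> (\<phi> has_real_derivative \<phi>' \<rho>) (at \<rho>)"
    and eq: "\<And>\<rho>. \<rho> \<in> C \<Longrightarrow> \<rho> * \<phi>' \<rho> = p * \<phi> \<rho>"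
    and \<rho>: "\<rho> \<in> C"
  shows "\<phi> \<rho> = \<phi> a * a powr (- p) * \<rho> powr p"
proof -
  define h where "h x = \<phi> x * x powr (- p)" for x
  have dh: "(h has_real_derivative 0) (at x)" if x: "x \<in> C" for x
  proof -
    have x0: "x > 0" using C x by auto
    have "(h has_real_derivative \<phi>' x * x powr (- p) + \<phi> x * (- p * x powr (- p - 1))) (at x)"
      unfolding h_def using x0 by (auto intro!: derivative_eq_intros d x)
    moreover have "x powr (- p) = x * x powr (- p - 1)" using x0 by (simp add: powr_mult_base)
    then have "\<phi>' x * x powr (- p) + \<phi> x * (- p * x powr (- p - 1)) = 0"
      using eq[OF x] by (simp add: algebra_simps)
    ultimately show ?thesis by simp
  qed
  have "convex C" using C(2) by (simp add: is_interval_connected_1 flip: is_interval_convex_1)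
  then obtain c where "\<And>x. x \<in> C \<Longrightarrow> h x = c"
    using has_field_derivative_zero_constant[of C h] dh has_field_derivative_at_within by metis
  then have "h \<rho> = h a" using \<rho> C(4) by simp
  then show ?thesis using \<rho> C(3)
    by (auto simp: h_def powr_minus field_simps)
qed

theorem theorem1p2:
  fixes \<phi> :: "real \<Rightarrow> real"
  assumes "\<phi> C1_differentiable_on {0<..}"
    and "\<exists>\<eta>>0. \<phi> \<eta> > 0"
    and "all_solutions_near_circular_motions_periodic \<phi>"
  shows "\<exists>K>0. (\<forall>\<eta>>0. \<phi> \<eta> = K) \<or> (\<forall>\<eta>>0. \<phi> \<eta> = K * \<eta> powr (-3/2))"
proof -
  note per = assms(3)
  obtain \<phi>' where d: "\<And>\<rho>. \<rho> > 0 \<Longrightarrow> (\<phi> has_real_derivative \<phi>' \<rho>) (at \<rho>)"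
    and cont': "continuous_on {0<..} \<phi>'"
    using assms(1) unfolding C1_differentiable_on_def has_real_derivative_iff_has_vector_derivative
    by auto
  have cont: "continuous_on {0<..} \<phi>"
    by (rule DERIV_continuous_on[where D=\<phi>']) (auto intro: has_field_derivative_at_within d)
  obtain a where a: "a > 0" "\<phi> a > 0" using assms(2) by blast
  define P where "P = {\<rho> \<in> {0<..}. \<phi> \<rho> > 0}"
  define C where "C = connected_component_set P a"
  have "open P"
    using continuous_open_preimage[OF cont open_greaterThan open_greaterThan, of 0]
    by (simp add: P_def Int_def vimage_def)
  then have C: "open C" "connected C" "C \<subseteq> P" "a \<in> C"
    using a connected_component_subset[of P a]
    by (auto simp: C_def P_def open_connected_component connected_connected_component)
  have Cpos: "\<rho> > 0" "\<phi> \<rho> > 0" if "\<rho> \<in> C" for \<rho> using C(3) that by (auto simp: P_def)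
  define \<kappa> where "\<kappa> \<rho> = 4 + 2 * \<rho> * \<phi>' \<rho> / \<phi> \<rho>" for \<rho>
  have \<kappa>: "\<kappa> \<rho> \<ge> 0" "sqrt (\<kappa> \<rho>) \<in> \<rat>" if "\<rho> \<in> C" for \<rho>
    using apsidal_frequency_rational[OF per cont Cpos[OF that] d[OF Cpos(1)[OF that]]]
    by (auto simp: \<kappa>_def)
  have "continuous_on C (\<lambda>\<rho>. sqrt (\<kappa> \<rho>))"
    unfolding \<kappa>_def using Cpos
    by (intro continuous_intros continuous_on_subset[OF cont] continuous_on_subset[OF cont']) force+
  moreover have "(\<lambda>\<rho>. sqrt (\<kappa> \<rho>)) ` C \<subseteq> \<rat>" using \<kappa>(2) by blast
  then have "countable ((\<lambda>\<rho>. sqrt (\<kappa> \<rho>)) ` C)" using countable_rat countable_subset by blast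
  ultimately have "sqrt (\<kappa> \<rho>) = sqrt (\<kappa> a)" if "\<rho> \<in> C" for \<rho>
    using constant_of_countable_range[OF C(2) _ _ that C(4)] by blast
  then have \<kappa>c: "\<kappa> \<rho> = \<kappa> a" if "\<rho> \<in> C" for \<rho> using that by simp
  define p where "p = (\<kappa> a - 4) / 2"
  define K where "K = \<phi> a * a powr (- p)"
  have K: "K > 0" using a by (simp add: K_def)
  have powC: "\<phi> \<rho> = K * \<rho> powr p" if "\<rho> \<in> C" for \<rho>
    unfolding K_def
  proof (rule power_law_of_logarithmic_derivative[OF C(1,2) _ C(4) d _ that])
    show "\<rho> * \<phi>' \<rho> = p * \<phi> \<rho>" if "\<rho> \<in> C" for \<rho>
      using \<kappa>c[OF that] Cpos[OF that] by (simp add: p_def \<kappa>_def[of \<rho>] field_simps)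
  qed (use Cpos in auto)
  \<comment> \<open>The power law keeps \<open>\<phi>\<close> positive at the boundary of \<open>C\<close>, so \<open>C\<close> is all of \<open>(0, \<infinity>)\<close>.\<close>
  have cl: "x \<in> C" if x: "x > 0" "x \<in> closure C" for x
  proof -
    define E where "E = {\<rho> \<in> {0<..}. \<phi> \<rho> - K * \<rho> powr p = 0}"
    have "continuous_on {0<..} (\<lambda>\<rho>. \<phi> \<rho> - K * \<rho> powr p)"
      by (intro continuous_intros cont) auto
    then have "closedin (top_of_set {0<..}) E"
      unfolding E_def by (rule continuous_closedin_preimage_constant)
    then obtain T where T: "closed T" "E = {0<..} \<inter> T" by (auto simp: closedin_closed)
    have "C \<subseteq> E" using powC Cpos by (auto simp: E_def)
    then have "closure C \<subseteq> T" using T by (intro closure_minimal) auto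
    then have "x \<in> E" using x T by auto
    then have "x \<in> P" using K x by (simp add: E_def P_def)
    moreover have "connected (insert x C)"
      by (rule connected_intermediate_closure[OF C(2)]) (use x closure_subset in auto)
    ultimately have "insert x C \<subseteq> connected_component_set P a"
      using C by (intro connected_component_maximal) auto
    then show ?thesis by (simp add: C_def)
  qed
  have "closedin (top_of_set {0<..}) C"
  proof -
    have "C = {0<..} \<inter> closure C" using cl Cpos closure_subset[of C] by auto
    then show ?thesis by (auto simp: closedin_closed)
  qed
  moreover have "openin (top_of_set {0<..}) C"
    using C(1) Cpos(1) by (auto intro: open_subset)
  moreover have "connected {0::real<..}" by simp
  ultimately have "C = {0<..}" using C(4) unfolding connected_clopen by blast
  then have pow: "\<phi> \<eta> = K * \<eta> powr p" if "\<eta> > 0" for \<eta> using powC that by simp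
  have "\<kappa> a \<noteq> 0"
  proof
    assume "\<kappa> a = 0"
    then have p2: "p = -2" by (simp add: p_def)
    have "\<phi> \<eta> = K / \<eta>\<^sup>2" if "\<eta> > 0" for \<eta>
      using pow[OF that] that unfolding p2 by (simp add: powr_minus divide_inverse)
    then show False using no_inverse_cube_force[OF per K] by blast
  qed
  then have "p > -2" using \<kappa>(1)[OF C(4)] by (simp add: p_def)
  then have "p = 0 \<or> p = -3/2" using power_force_exponent[OF per K pow] by blast
  then show ?thesis using pow K by (intro exI[of _ K]) auto
qed

end
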